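(* For every integer $d \geq 1$ and every real $0 < \epsilon < 1$ there exist constants $C > 0$ and $c > 0$, depending only on $d$ and $\epsilon$, such that the following holds. Let $V \subset \mathbb{C}^d$ be a set of size $n$ and suppose that for some integer $r \geq 4$ we have $$\mathbf{AP}_r(V) \geq C \cdot \frac{n^2}{r^{d-\epsilon}}.$$ Then there exists a subset $\tilde V \subset V$ of size at least $c \cdot \frac{n}{r^{(2d/\epsilon) - 1}}$ that is contained in an affine hyperplane of $\mathbb{C}^d$.
   Context: An $r$-term arithmetic progression in $\mathbb{C}^d$ is a set of $r$ (distinct) points of the form $\{y, y+x, y+2x, \ldots, y+(r-1)x\}$ with $x, y \in \mathbb{C}^d$. For a finite set $V \subset \mathbb{C}^d$, $\mathbf{AP}_r(V)$ denotes the number of $r$-term arithmetic progressions (counted as sets) contained in $V$. *)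

theory Defs
  imports "HOL-Analysis.Analysis"
begin

text \<open>The condition \<open>card A = r\<close> says that the \<open>r\<close> points \<open>y + k x\<close> are pairwise distinct.\<close>

definition arith_prog :: "nat \<Rightarrow> (complex ^ 'd) set \<Rightarrow> bool" where
  "arith_prog r A \<longleftrightarrow>
     (\<exists>y x. A = (\<lambda>k. y + of_nat k *s x) ` {..<r} \<and> card A = r)"

text \<open>Progressions are counted as sets, so a progression and its reversal count once.\<close>

definition num_arith_progs :: "nat \<Rightarrow> (complex ^ 'd) set \<Rightarrow> nat" where
  "num_arith_progs r V = card {A. A \<subseteq> V \<and> arith_prog r A}"

text \<open>
  Hyperplanes are complex ones (complex codimension 1). The linear form is bilinear rather than
  the inner product, as the latter is real-valued on this type.
\<close>

definition affine_hyperplane :: "(complex ^ 'd) set \<Rightarrow> bool" where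
  "affine_hyperplane H \<longleftrightarrow>
     (\<exists>a b. a \<noteq> 0 \<and> H = {x. (\<Sum>i\<in>UNIV. a $ i * x $ i) = b})"

end

theory Submission
  imports Defs "HOL-Library.Function_Algebras"
begin

text \<open>
  Consider the polynomials of degree less than \<open>r/4\<close>, evaluated at the points. On a progression
  they restrict to polynomials in the index, so the values at its \<open>r\<close> points span few dimensions.
  After a suitable positive weighting of the points, the reproducing kernel of the polynomial
  space has its diagonal bounded below by a constant multiple of the average. The local
  dependencies then force a large off-diagonal part on every progression, while the total mass of
  the kernel is bounded by the dimension. Hence either there are few progressions or the weighting
  does not exist; the latter means that some polynomials vanish on a subset containing many of the
  progressions.
  A polynomial of degree less than \<open>r\<close> vanishing there, with nonzero gradient at some point,
  vanishes on every line spanned by a progression through that point, so all these progressions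
  lie in the tangent hyperplane. This argument loses a factor \<open>r\<close>, which is removed by applying it
  to a power of the point set.
\<close>

text \<open>The weighting is a coarse form of radial isotropic position. It can fail only if some
  subspace of polynomials lives on too few points, measured by the slope (points in the support) /
  (dimension). Choosing a space of minimal slope removes this obstruction, and the points outside
  its support are common zeros. The factor \<open>r\<close> is lost in a double count. The kernel
  has total energy at most its dimension \<open>s\<close>, and a progression receives about r (s /
  n)^2 of it; but a pair of points may occur in each of the r^2 pairs of positions. So about r n^2 /
  s progressions can leave the zero set. In \<open>D\<close> dimensions \<open>s\<close> is of order
  r^D at best, which misses n^2 / r^D by the factor \<open>r\<close>. A nonzero gradient can be
  guaranteed only at some point of the zero set, and perhaps only for a derivative of the given
  polynomial. Hence the zero set is first thinned until each remaining point lies on many of the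
  remaining progressions.\<close>

section \<open>Orthonormal systems and leverage scores\<close>

text \<open>Serves both for univariate polynomials on the indices and for multivariate ones on the
  points. A nonzero vector may evaluate to zero everywhere, so vectors are not identified with
  functions.\<close>

locale eval_space = vector_space scale
  for scale :: "complex \<Rightarrow> 'v::ab_group_add \<Rightarrow> 'v" +
  fixes ev :: "'a \<Rightarrow> 'v \<Rightarrow> complex"
  assumes ev_add: "ev u (f + g) = ev u f + ev u g"
    and ev_scale: "ev u (scale a f) = a * ev u f"
begin

lemma ev_zero [simp]: "ev u 0 = 0"
  using ev_scale[of u 0 0] by simp

lemma ev_sum: "ev u (\<Sum>i\<in>I. F i) = (\<Sum>i\<in>I. ev u (F i))"
  by (induction I rule: infinite_finite_induct) (auto simp: ev_add)

lemma ev_diff: "ev u (f - g) = ev u f - ev u g"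
  using ev_add[of u "f - g" g] by simp

definition ip :: "'a set \<Rightarrow> ('a \<Rightarrow> real) \<Rightarrow> 'v \<Rightarrow> 'v \<Rightarrow> complex" where
  "ip X w f g = (\<Sum>u\<in>X. of_real (w u) * ev u f * cnj (ev u g))"

definition nsq :: "'a set \<Rightarrow> ('a \<Rightarrow> real) \<Rightarrow> 'v \<Rightarrow> real" where
  "nsq X w f = (\<Sum>u\<in>X. w u * (cmod (ev u f))\<^sup>2)"

definition ortho :: "'a set \<Rightarrow> ('a \<Rightarrow> real) \<Rightarrow> 'v set \<Rightarrow> bool" where
  "ortho X w Q \<longleftrightarrow> finite Q \<and> (\<forall>e\<in>Q. \<forall>e'\<in>Q. ip X w e e' = (if e = e' then 1 else 0))"

text \<open>For orthonormal \<open>Q\<close> this is the squared norm of evaluation at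
  \<open>u\<close> on \<open>span Q\<close>, the diagonal of the reproducing kernel.\<close>

definition lev :: "'v set \<Rightarrow> 'a \<Rightarrow> real" where
  "lev Q u = (\<Sum>e\<in>Q. (cmod (ev u e))\<^sup>2)"

lemma lev_nonneg: "lev Q u \<ge> 0"
  by (auto simp: lev_def intro: sum_nonneg)

lemma ip_add_left: "ip X w (f + g) h = ip X w f h + ip X w g h"
  by (simp add: ip_def ev_add algebra_simps sum.distrib)

lemma ip_diff_left: "ip X w (f - g) h = ip X w f h - ip X w g h"
  by (simp add: ip_def ev_diff algebra_simps sum_subtractf)

lemma ip_scale_left: "ip X w (scale a f) h = a * ip X w f h"
  by (simp add: ip_def ev_scale sum_distrib_left algebra_simps)

lemma ip_zero_left [simp]: "ip X w 0 h = 0"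
  by (simp add: ip_def)

lemma ip_sum_left: "ip X w (\<Sum>i\<in>I. F i) h = (\<Sum>i\<in>I. ip X w (F i) h)"
  by (induction I rule: infinite_finite_induct) (auto simp: ip_add_left)

lemma ip_cnj: "cnj (ip X w f g) = ip X w g f"
  by (simp add: ip_def algebra_simps)

lemma ip_self: "ip X w f f = of_real (nsq X w f)"
proof -
  have *: "of_real (w u) * ev u f * cnj (ev u f) = of_real (w u * (cmod (ev u f))\<^sup>2)" for u
    by (simp add: complex_norm_square mult.assoc del: of_real_power)
  show ?thesis
    unfolding ip_def nsq_def of_real_sum by (intro sum.cong refl *)
qed

lemma nsq_nonneg: "(\<And>u. u \<in> X \<Longrightarrow> 0 \<le> w u) \<Longrightarrow> 0 \<le> nsq X w f"
  by (auto simp: nsq_def intro!: sum_nonneg)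

lemma ortho_coeff:
  assumes "ortho X w Q" "e \<in> Q"
  shows "ip X w (\<Sum>i\<in>Q. scale (a i) i) e = a e"
proof -
  have "ip X w (\<Sum>i\<in>Q. scale (a i) i) e = (\<Sum>i\<in>Q. if i = e then a i else 0)"
    unfolding ip_sum_left ip_scale_left
    by (rule sum.cong) (use assms in \<open>auto simp: ortho_def\<close>)
  then show ?thesis
    using assms by (simp add: ortho_def)
qed

lemma ortho_independent:
  assumes "ortho X w Q"
  shows "independent Q"
proof -
  have fin: "finite Q" using assms by (simp add: ortho_def)
  have "a e = 0" if "(\<Sum>i\<in>Q. scale (a i) i) = 0" "e \<in> Q" for a e
    using ortho_coeff[OF assms that(2), of a] that(1) by simp
  then show ?thesis
    using fin by (auto simp: dependent_finite)
qed

lemma ortho_nsq: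
  assumes "ortho X w Q"
  shows "nsq X w (\<Sum>i\<in>Q. scale (a i) i) = (\<Sum>i\<in>Q. (cmod (a i))\<^sup>2)"
proof -
  let ?g = "\<Sum>i\<in>Q. scale (a i) i"
  have "ip X w ?g ?g = (\<Sum>i\<in>Q. a i * cnj (ip X w ?g i))"
    by (subst ip_sum_left) (simp only: ip_scale_left ip_cnj)
  also have "\<dots> = (\<Sum>i\<in>Q. a i * cnj (a i))"
    by (rule sum.cong) (auto simp: ortho_coeff[OF assms])
  also have "\<dots> = of_real (\<Sum>i\<in>Q. (cmod (a i))\<^sup>2)"
    by (simp add: complex_norm_square del: of_real_power)
  finally show ?thesis
    using ip_self[of X w ?g] of_real_eq_iff by metis
qed

lemma span_ortho:
  assumes "ortho X w Q" "f \<in> span Q"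
  obtains a where "f = (\<Sum>i\<in>Q. scale (a i) i)"
  using assms span_finite[of Q] by (auto simp: ortho_def)

lemma ev_sq_le_lev:
  assumes "ortho X w Q" "f \<in> span Q"
  shows "(cmod (ev u f))\<^sup>2 \<le> lev Q u * nsq X w f"
proof -
  obtain a where f: "f = (\<Sum>i\<in>Q. scale (a i) i)"
    using span_ortho[OF assms] .
  have "cmod (ev u f) \<le> (\<Sum>i\<in>Q. cmod (a i) * cmod (ev u i))"
    unfolding f ev_sum ev_scale by (rule order_trans[OF norm_sum]) (simp add: norm_mult)
  then have "(cmod (ev u f))\<^sup>2 \<le> (\<Sum>i\<in>Q. cmod (a i) * cmod (ev u i))\<^sup>2"
    by (intro power_mono) auto
  also have "\<dots> \<le> (\<Sum>i\<in>Q. (cmod (a i))\<^sup>2) * (\<Sum>i\<in>Q. (cmod (ev u i))\<^sup>2)"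
    by (rule Cauchy_Schwarz_ineq_sum)
  also have "\<dots> = lev Q u * nsq X w f"
    unfolding f ortho_nsq[OF assms(1)] lev_def by simp
  finally show ?thesis .
qed

lemma sum_lev:
  assumes "ortho X w Q"
  shows "(\<Sum>u\<in>X. w u * lev Q u) = card Q"
proof -
  have "nsq X w e = 1" if "e \<in> Q" for e
    using ip_self[of X w e] assms that unfolding ortho_def
    by (metis of_real_1 of_real_eq_iff)
  then have "(\<Sum>e\<in>Q. nsq X w e) = card Q" by simp
  then show ?thesis
    unfolding nsq_def lev_def sum_distrib_left by (subst sum.swap) simp
qed

section \<open>The reproducing kernel and orthonormal bases for degenerate forms\<close>

text \<open>The Riesz representer of evaluation at \<open>u\<close>; the conjugates arise because
  \<open>ip\<close> is conjugate-linear in its second argument.\<close>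

definition ker_vec :: "'v set \<Rightarrow> 'a \<Rightarrow> 'v" where
  "ker_vec Q u = (\<Sum>e\<in>Q. scale (cnj (ev u e)) e)"

lemma ker_vec_span: "ker_vec Q u \<in> span Q"
  unfolding ker_vec_def by (intro span_sum span_scale span_base)

lemma ev_ker_vec_self: "ev u (ker_vec Q u) = of_real (lev Q u)"
  by (simp add: ker_vec_def ev_sum ev_scale lev_def complex_norm_square mult.commute
      del: of_real_power)

lemma nsq_ker_vec: "ortho X w Q \<Longrightarrow> nsq X w (ker_vec Q u) = lev Q u"
  unfolding ker_vec_def lev_def by (subst ortho_nsq) auto

text \<open>An orthonormal basis of \<open>span B\<close> modulo vectors that vanish wherever the
  weight is positive. The quotient matters because weights may be indicators of subsets and
  evaluation may have a kernel.\<close>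

definition basis :: "'a set \<Rightarrow> ('a \<Rightarrow> real) \<Rightarrow> 'v set \<Rightarrow> 'v set \<Rightarrow> bool" where
  "basis X w B Q \<longleftrightarrow> ortho X w Q \<and> Q \<subseteq> span B \<and>
     (\<forall>f\<in>span B. \<exists>g\<in>span Q. \<forall>u\<in>X. w u > 0 \<longrightarrow> ev u f = ev u g)"

text \<open>Gram--Schmidt for a form that may be degenerate: vectors of norm zero are dropped.\<close>

lemma basis_exists_form:
  assumes "finite X" "\<And>u. u \<in> X \<Longrightarrow> 0 \<le> w u" "finite B"
  shows "\<exists>Q. basis X w B Q"
  using assms(3)
proof (induction B rule: finite_induct)
  case empty
  have "basis X w {} {}"
    by (auto simp: basis_def ortho_def)
  then show ?case by blast
next
  case (insert b B)
  then obtain Q where Q: "basis X w B Q" by blast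
  then have oQ: "ortho X w Q" and QB: "Q \<subseteq> span B"
    and app: "\<And>f. f \<in> span B \<Longrightarrow> \<exists>g\<in>span Q. \<forall>u\<in>X. w u > 0 \<longrightarrow> ev u f = ev u g"
    by (auto simp: basis_def)
  have finQ: "finite Q" using oQ by (simp add: ortho_def)
  define p where "p = (\<Sum>e\<in>Q. scale (ip X w b e) e)"
  define r where "r = b - p"
  have p_span: "p \<in> span Q"
    unfolding p_def by (intro span_sum span_scale span_base)
  have r_orth: "ip X w r e = 0" if "e \<in> Q" for e
    unfolding r_def ip_diff_left p_def ortho_coeff[OF oQ that] by simp
  have span_B: "span B \<subseteq> span (insert b B)"
    by (rule span_mono) auto
  have r_in: "r \<in> span (insert b B)"
    unfolding r_def
  proof (rule span_diff)
    show "b \<in> span (insert b B)" by (simp add: span_base)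
    have "span Q \<subseteq> span B" using QB by (simp add: span_minimal)
    then show "p \<in> span (insert b B)" using p_span span_B by blast
  qed
  \<comment> \<open>The vectors that agree with an element of \<open>span Q'\<close> where
    \<open>w\<close> is positive form a subspace, so only the new generator \<open>b\<close> needs
    an argument.\<close>
  have close: "\<exists>Q. basis X w (insert b B) Q"
    if Q': "ortho X w Q'" "Q' \<subseteq> span (insert b B)" "Q \<subseteq> span Q'"
      and b': "\<exists>g\<in>span Q'. \<forall>u\<in>X. w u > 0 \<longrightarrow> ev u b = ev u g" for Q'
  proof -
    let ?S = "{f. \<exists>g\<in>span Q'. \<forall>u\<in>X. w u > 0 \<longrightarrow> ev u f = ev u g}"
    have "subspace ?S"
    proof (rule subspaceI)
      show "0 \<in> ?S" by (auto intro!: bexI[of _ 0] span_zero)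
    next
      fix x y assume "x \<in> ?S" "y \<in> ?S"
      then obtain g h where "g \<in> span Q'" "\<forall>u\<in>X. w u > 0 \<longrightarrow> ev u x = ev u g"
        "h \<in> span Q'" "\<forall>u\<in>X. w u > 0 \<longrightarrow> ev u y = ev u h" by blast
      then show "x + y \<in> ?S"
        by (auto intro!: bexI[of _ "g + h"] span_add simp: ev_add)
    next
      fix c x assume "x \<in> ?S"
      then obtain g where "g \<in> span Q'" "\<forall>u\<in>X. w u > 0 \<longrightarrow> ev u x = ev u g" by blast
      then show "scale c x \<in> ?S"
        by (auto intro!: bexI[of _ "scale c g"] span_scale simp: ev_scale)
    qed
    moreover have "insert b B \<subseteq> ?S"
    proof
      fix f assume "f \<in> insert b B"
      then consider "f = b" | "f \<in> B" by blast
      then show "f \<in> ?S"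
      proof cases
        case 1 then show ?thesis using b' by simp
      next
        case 2
        then obtain g where "g \<in> span Q" "\<forall>u\<in>X. w u > 0 \<longrightarrow> ev u f = ev u g"
          using app[of f] span_base by blast
        moreover have "span Q \<subseteq> span Q'" using Q'(3) by (simp add: span_minimal)
        ultimately show ?thesis by blast
      qed
    qed
    ultimately have "span (insert b B) \<subseteq> ?S" by (simp add: span_minimal)
    then show ?thesis
      using Q' unfolding basis_def by blast
  qed
  show ?case
  proof (cases "nsq X w r = 0")
    case True
    have "ev u b = ev u p" if "u \<in> X" "w u > 0" for u
    proof -
      have "\<forall>u\<in>X. w u * (cmod (ev u r))\<^sup>2 = 0"
        using True assms(1,2) unfolding nsq_def
        by (subst (asm) sum_nonneg_eq_0_iff) auto
      then have "ev u r = 0" using that by auto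
      then show ?thesis by (simp add: r_def ev_diff)
    qed
    then show ?thesis
      using p_span QB span_B oQ by (intro close[of Q]) (auto intro: span_base)
  next
    case False
    then have pos: "nsq X w r > 0"
      using nsq_nonneg[of X w r] assms(2) by force
    define a where "a = 1 / sqrt (nsq X w r)"
    define e where "e = scale (of_real a) r"
    have a0: "a \<noteq> 0" using pos by (simp add: a_def)
    have e_orth: "ip X w e i = 0" "ip X w i e = 0" if "i \<in> Q" for i
    proof -
      show "ip X w e i = 0" using r_orth[OF that] by (simp add: e_def ip_scale_left)
      then show "ip X w i e = 0" using ip_cnj[of X w e i] by simp
    qed
    have "nsq X w e = a\<^sup>2 * nsq X w r"
      unfolding nsq_def e_def ev_scale norm_mult power_mult_distrib sum_distrib_left
      by (rule sum.cong) auto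
    also have "\<dots> = 1" using pos by (simp add: a_def power_divide)
    finally have e1: "ip X w e e = 1" by (simp add: ip_self)
    have "e \<notin> Q" using e_orth(1)[of e] e1 by auto
    then have "ortho X w (insert e Q)"
      using oQ e_orth e1 finQ by (auto simp: ortho_def)
    moreover have "insert e Q \<subseteq> span (insert b B)"
      using r_in QB span_B by (auto simp: e_def intro: span_scale)
    moreover have "Q \<subseteq> span (insert e Q)" by (auto intro: span_base)
    moreover have "b \<in> span (insert e Q)"
    proof -
      have "r = scale (of_real (1 / a)) e"
        using a0 by (simp add: e_def flip: of_real_mult)
      then have "r \<in> span (insert e Q)"
        by (simp add: span_base span_scale)
      moreover have "p \<in> span (insert e Q)"
        using p_span span_mono[of Q "insert e Q"] by blast
      ultimately have "r + p \<in> span (insert e Q)" by (rule span_add)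
      then show ?thesis by (simp add: r_def)
    qed
    ultimately show ?thesis
      by (intro close[of "insert e Q"]) auto
  qed
qed

lemma ev_sq_le_lev_basis:
  assumes "basis X w B Q" "\<And>u. u \<in> X \<Longrightarrow> 0 \<le> w u" "f \<in> span B" "u \<in> X" "w u > 0"
  shows "(cmod (ev u f))\<^sup>2 \<le> lev Q u * nsq X w f"
proof -
  obtain g where g: "g \<in> span Q" "\<forall>u\<in>X. w u > 0 \<longrightarrow> ev u f = ev u g"
    using assms(1,3) by (auto simp: basis_def)
  have "nsq X w f = nsq X w g"
    unfolding nsq_def
  proof (rule sum.cong)
    fix x assume "x \<in> X"
    then show "w x * (cmod (ev x f))\<^sup>2 = w x * (cmod (ev x g))\<^sup>2"
      using g(2) assms(2)[of x] by (cases "w x = 0") auto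
  qed simp
  then show ?thesis
    using ev_sq_le_lev[of X w Q g u] g assms by (auto simp: basis_def)
qed

section \<open>Weights with balanced leverage\<close>

text \<open>Leverage is the largest ratio of |f(u)|^2 to the squared norm of f: heavier weights
  enlarge the norm, and a smaller space leaves fewer f. The inequality for \<open>Q\<close> is
  tested on the kernel of \<open>Q'\<close>, which is extremal for \<open>Q'\<close>.\<close>

lemma lev_mono:
  assumes Q: "basis X w B Q" "\<And>u. u \<in> X \<Longrightarrow> 0 \<le> w u"
    and Q': "ortho X w' Q'" "Q' \<subseteq> span B" "\<And>u. u \<in> X \<Longrightarrow> w u \<le> w' u"
    and u: "u \<in> X" "w u > 0"
  shows "lev Q' u \<le> lev Q u"
proof (cases "lev Q' u = 0")
  case True
  then show ?thesis by (simp add: lev_nonneg)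
next
  case False
  let ?k = "ker_vec Q' u"
  have "span Q' \<subseteq> span B" using Q'(2) by (simp add: span_minimal)
  then have "?k \<in> span B" using ker_vec_span by blast
  then have "(cmod (ev u ?k))\<^sup>2 \<le> lev Q u * nsq X w ?k"
    using ev_sq_le_lev_basis[OF Q _ u] by blast
  also have "nsq X w ?k \<le> nsq X w' ?k"
    unfolding nsq_def by (intro sum_mono mult_right_mono Q'(3)) auto
  then have "lev Q u * nsq X w ?k \<le> lev Q u * nsq X w' ?k"
    by (simp add: lev_nonneg mult_left_mono)
  also have "nsq X w' ?k = lev Q' u" by (rule nsq_ker_vec[OF Q'(1)])
  finally have "(lev Q' u)\<^sup>2 \<le> lev Q u * lev Q' u"
    by (simp add: ev_ker_vec_self lev_nonneg)
  then have "lev Q' u * lev Q' u \<le> lev Q u * lev Q' u"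
    by (simp add: power2_eq_square)
  then show ?thesis
    using False lev_nonneg[of Q' u] mult_right_le_imp_le by force
qed

text \<open>
  The weights are \<open>2\<^bsup>t u\<^esup>\<close>, where \<open>t\<close> is maximal subject to a cap \<open>R\<close> and to no point with \<open>t u > 0\<close>
  having more than half of the average leverage. Raising \<open>t u\<close> by one at most doubles the leverage
  at \<open>u\<close> and does not increase it elsewhere, so points below the cap have at least a quarter of the
  average. If some point reaches the cap, the values of \<open>t\<close> have a large gap; the points above the
  gap then carry almost the rank of the space restricted to them, against \<open>semi\<close>.
\<close>

lemma leverage_weights:
  assumes X: "finite X" "X \<noteq> {}" and B: "finite B"
    and semi: "\<And>B'. B' \<subseteq> span B \<Longrightarrow> independent B' \<Longrightarrow> B' \<noteq> {} \<Longrightarrow>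
      card X * card B' \<le> card B * card {u \<in> X. \<exists>f\<in>B'. ev u f \<noteq> 0}"
    and indep: "independent B" "B \<noteq> {}"
  shows "\<exists>w Q. (\<forall>u\<in>X. w u > 0) \<and> basis X w B Q \<and>
    (\<forall>u\<in>X. card B / (4 * card X) \<le> w u * lev Q u)"
proof -
  define n where "n = card X"
  define s where "s = card B"
  define \<alpha> where "\<alpha> = real s / (2 * real n)"
  have n0: "n > 0" using X by (simp add: n_def card_gt_0_iff)
  have s0: "s > 0" using B indep by (simp add: s_def card_gt_0_iff)
  have \<alpha>0: "\<alpha> > 0" using n0 s0 by (simp add: \<alpha>_def)
  \<comment> \<open>This is \<open>semi\<close> for a single vector; it makes the form definite for
    every positive weight.\<close>
  have posdef: "f = 0" if "f \<in> span B" "\<And>u. u \<in> X \<Longrightarrow> ev u f = 0" for f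
  proof (rule ccontr)
    assume "f \<noteq> 0"
    then have "card X * card {f} \<le> card B * card {u \<in> X. \<exists>g\<in>{f}. ev u g \<noteq> 0}"
      using that(1) by (intro semi) auto
    moreover have "card {u \<in> X. \<exists>g\<in>{f}. ev u g \<noteq> 0} = 0"
      using that(2) by (simp add: card_eq_0_iff)
    ultimately show False using n0 n_def by simp
  qed
  have "\<forall>H. \<exists>Q. basis X (\<lambda>u. if u \<in> H then 1 else 0) B Q"
    using basis_exists_form[OF X(1) _ B] by simp
  then obtain QH where QH: "\<And>H. basis X (\<lambda>u. if u \<in> H then 1 else 0) B (QH H)"
    by metis
  \<comment> \<open>A bound for the leverages of all indicator weights at once, so that it can be
    fixed before \<open>t\<close>, on which the set above the gap will depend.\<close>
  define K where "K = (\<Sum>H\<in>Pow X. \<Sum>v\<in>X. lev (QH H) v)"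
  obtain \<Gamma>' where \<Gamma>': "K < 2 ^ \<Gamma>'"
    using real_arch_pow[of 2 K] by auto
  define \<Gamma> where "\<Gamma> = Suc \<Gamma>'"
  have \<Gamma>: "K < 2 ^ \<Gamma>" "\<Gamma> > 0"
    using less_trans[OF \<Gamma>', of "2 ^ \<Gamma>"] by (auto simp: \<Gamma>_def)
  \<comment> \<open>Below \<open>R\<close> there are \<open>n + 1\<close> disjoint blocks of
    \<Gamma> consecutive values, one more than there are points. Some block therefore contains no
    value of \<open>t\<close>, and a point at the cap lies above it.\<close>
  define R where "R = (n + 1) * \<Gamma> + 1"
  define wt :: "('a \<Rightarrow> nat) \<Rightarrow> 'a \<Rightarrow> real" where "wt t u = 2 ^ t u" for t u
  have wt_pos: "wt t u > 0" for t u by (simp add: wt_def)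
  have "\<forall>t. \<exists>Q. basis X (wt t) B Q"
    using basis_exists_form[OF X(1) _ B] wt_pos less_imp_le by metis
  then obtain Qt where Qt: "\<And>t. basis X (wt t) B (Qt t)"
    by metis
  define P where "P t \<longleftrightarrow> (\<forall>u\<in>X. t u \<le> R \<and> (t u > 0 \<longrightarrow> wt t u * lev (Qt t) u \<le> \<alpha>))" for t
  have "P (\<lambda>_. 0)" by (simp add: P_def)
  moreover have "\<forall>t. P t \<longrightarrow> (\<Sum>u\<in>X. t u) < R * n + 1"
  proof (intro allI impI)
    fix t assume "P t"
    then have "(\<Sum>u\<in>X. t u) \<le> (\<Sum>u\<in>X. R)"
      by (intro sum_mono) (auto simp: P_def)
    then show "(\<Sum>u\<in>X. t u) < R * n + 1" by (simp add: n_def mult.commute)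
  qed
  ultimately have "\<exists>t. P t \<and> (\<forall>t'. P t' \<longrightarrow> (\<Sum>u\<in>X. t' u) \<le> (\<Sum>u\<in>X. t u))"
    by (rule Lattices_Big.ex_has_greatest_nat[where f = "\<lambda>t. \<Sum>u\<in>X. t u"])
  then obtain t where Pt: "P t"
    and tmax: "\<And>t'. P t' \<Longrightarrow> (\<Sum>u\<in>X. t' u) \<le> (\<Sum>u\<in>X. t u)"
    by blast
  define w where "w = wt t"
  have wpos: "w u > 0" for u by (simp add: w_def wt_pos)
  have wnn: "w u \<ge> 0" for u using wpos[of u] by simp
  have bQ: "basis X w B (Qt t)" using Qt w_def by simp
  have small: "\<alpha> / 2 < w u * lev (Qt t) u" if u: "u \<in> X" "t u < R" for u
  proof -
    define t' where "t' = t(u := t u + 1)"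
    have mono: "lev (Qt t') v \<le> lev (Qt t) v" if "v \<in> X" for v
      using Qt[of t'] that wt_pos
      by (intro lev_mono[OF Qt, of t "wt t'"]) (auto simp: basis_def wt_def t'_def)
    have "(\<Sum>v\<in>X. t' v) = (\<Sum>v\<in>X. t v + (if v = u then 1 else 0))"
      by (rule sum.cong) (auto simp: t'_def)
    also have "\<dots> = (\<Sum>v\<in>X. t v) + 1"
      using u X by (simp add: sum.distrib)
    finally have "\<not> P t'" using tmax[of t'] by auto
    then obtain v where v: "v \<in> X" "t' v \<le> R \<Longrightarrow> t' v > 0 \<and> wt t' v * lev (Qt t') v > \<alpha>"
      unfolding P_def by force
    have "v = u"
    proof (rule ccontr)
      assume "v \<noteq> u"
      then have "t' v = t v" by (simp add: t'_def)
      then have "wt t v * lev (Qt t') v > \<alpha>" "t v > 0" using v Pt by (auto simp: P_def wt_def)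
      moreover have "wt t v * lev (Qt t') v \<le> wt t v * lev (Qt t) v"
        using mono[OF v(1)] wt_pos[of t v] by simp
      moreover have "wt t v * lev (Qt t) v \<le> \<alpha>"
        using Pt v(1) \<open>t v > 0\<close> by (auto simp: P_def)
      ultimately show False by linarith
    qed
    then have "\<alpha> < wt t' u * lev (Qt t') u"
      using v u by (auto simp: t'_def)
    also have "\<dots> = 2 * (wt t u * lev (Qt t') u)" by (simp add: wt_def t'_def)
    also have "\<dots> \<le> 2 * (w u * lev (Qt t) u)"
      using mono[OF u(1)] wt_pos[of t u] by (simp add: w_def)
    finally show ?thesis by simp
  qed
  have top: "t u < R" if u0: "u \<in> X" for u
  proof (rule ccontr)
    assume "\<not> t u < R"
    then have tu: "t u = R" using Pt u0 by (auto simp: P_def)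
    \<comment> \<open>Block \<open>j\<close> holds the values from \<open>j * \<Gamma> + 1\<close>
      to \<open>(j + 1) * \<Gamma>\<close>; truncated subtraction puts the value 0 into block
      0.\<close>
    have "\<not> {..n} \<subseteq> (\<lambda>u. (t u - 1) div \<Gamma>) ` X"
    proof
      assume "{..n} \<subseteq> (\<lambda>u. (t u - 1) div \<Gamma>) ` X"
      then have "card {..n} \<le> card ((\<lambda>u. (t u - 1) div \<Gamma>) ` X)"
        using X by (intro card_mono) auto
      also have "\<dots> \<le> n" unfolding n_def by (rule card_image_le[OF X(1)])
      finally show False by simp
    qed
    then obtain j where j: "j \<le> n" "\<And>v. v \<in> X \<Longrightarrow> (t v - 1) div \<Gamma> \<noteq> j" by blast
    define H where "H = {v \<in> X. t v > (j + 1) * \<Gamma>}"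
    have H: "H \<subseteq> X" "finite H" using X by (auto simp: H_def)
    have uH: "u \<in> H"
    proof -
      have "(j + 1) * \<Gamma> \<le> (n + 1) * \<Gamma>" using j by (intro mult_right_mono) auto
      then have "(j + 1) * \<Gamma> < t u" unfolding tu R_def by linarith
      then show ?thesis using u0 unfolding H_def by blast
    qed
    have low: "t v \<le> j * \<Gamma>" if "v \<in> X" "v \<notin> H" for v
    proof (rule ccontr)
      assume "\<not> t v \<le> j * \<Gamma>"
      then have "j * \<Gamma> \<le> t v - 1" "t v - 1 < (j + 1) * \<Gamma>"
        using that by (auto simp: H_def)
      then have "(t v - 1) div \<Gamma> = j"
        by (intro div_nat_eqI) (simp_all add: algebra_simps)
      then show False using j(2) that by blast
    qed
    \<comment> \<open>Represents the restrictions of \<open>span B\<close> to \<open>H\<close>;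
      their rank is \<rho>.\<close>
    define O1 where "O1 = QH H"
    define \<rho> where "\<rho> = card O1"
    have O1: "ortho X (\<lambda>u. if u \<in> H then 1 else 0) O1" "O1 \<subseteq> span B"
      using QH[of H] by (auto simp: basis_def O1_def)
    have O1_app: "\<exists>g\<in>span O1. \<forall>u\<in>H. ev u f = ev u g" if f: "f \<in> span B" for f
    proof -
      obtain g where g: "g \<in> span O1"
        "\<forall>u\<in>X. (0::real) < (if u \<in> H then 1 else 0) \<longrightarrow> ev u f = ev u g"
        using QH[of H] f unfolding basis_def O1_def by blast
      then have "\<forall>u\<in>H. ev u f = ev u g" using H(1) by auto
      then show ?thesis using g(1) by blast
    qed
    have finO1: "finite O1" using O1 by (simp add: ortho_def)
    have O1_span: "span O1 \<subseteq> span B" using O1(2) by (simp add: span_minimal)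
    \<comment> \<open>The vectors of \<open>span B\<close> vanishing on \<open>H\<close> have
      dimension at least \<open>s - \<rho>\<close> and live on \<open>n - card H\<close> points;
      \<open>semi\<close> applied to them gives the bound.\<close>
    have rank: "s * card H \<le> n * \<rho>"
    proof -
      let ?F = "{f \<in> span B. \<forall>u\<in>H. ev u f = 0}"
      obtain B' where B': "B' \<subseteq> ?F" "independent B'" "?F \<subseteq> span B'"
        using maximal_independent_subset[of ?F] by blast
      have finB': "finite B'"
        using independent_span_bound[OF B B'(2)] B'(1) by auto
      have "B \<subseteq> span (O1 \<union> B')"
      proof
        fix b assume "b \<in> B"
        then have b: "b \<in> span B" by (rule span_base)
        then obtain g where g: "g \<in> span O1" "\<forall>u\<in>H. ev u b = ev u g"
          using O1_app by blast
        have "b - g \<in> ?F" using b g O1_span by (auto simp: ev_diff intro: span_diff)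
        then have "b - g \<in> span (O1 \<union> B')"
          using B'(3) span_mono[of B' "O1 \<union> B'"] by blast
        moreover have "g \<in> span (O1 \<union> B')"
          using g(1) span_mono[of O1 "O1 \<union> B'"] by blast
        ultimately have "(b - g) + g \<in> span (O1 \<union> B')" by (rule span_add)
        then show "b \<in> span (O1 \<union> B')" by simp
      qed
      then have "s \<le> card (O1 \<union> B')"
        unfolding s_def using independent_span_bound[of "O1 \<union> B'" B] indep finO1 finB' by simp
      also have "\<dots> \<le> \<rho> + card B'" unfolding \<rho>_def by (rule card_Un_le)
      finally have s_le: "s \<le> \<rho> + card B'" .
      have cH: "card H \<le> n" unfolding n_def using H X by (intro card_mono) auto
      have "n * card B' \<le> s * (n - card H)"
      proof (cases "B' = {}")
        case False
        then have "n * card B' \<le> s * card {u \<in> X. \<exists>f\<in>B'. ev u f \<noteq> 0}"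
          unfolding n_def s_def using B' by (intro semi) auto
        also have "card {u \<in> X. \<exists>f\<in>B'. ev u f \<noteq> 0} \<le> card (X - H)"
          using B'(1) X by (intro card_mono) auto
        also have "card (X - H) = n - card H"
          unfolding n_def using H by (simp add: card_Diff_subset)
        finally show ?thesis by simp
      qed simp
      moreover have "n * s \<le> n * \<rho> + n * card B'"
        using s_le by (metis add_mult_distrib2 mult_le_mono2)
      moreover have "s * (n - card H) + s * card H = n * s"
        using cH by (simp add: mult.commute flip: add_mult_distrib2)
      ultimately show ?thesis by linarith
    qed
    have cH0: "card H > 0" using uH H by (auto simp: card_gt_0_iff)
    have \<rho>0: "\<rho> > 0"
      using rank s0 cH0 by (cases "\<rho> = 0") auto
    obtain O2 where O2: "basis X w O1 O2"
      using basis_exists_form[OF X(1) _ finO1, of w] wnn by blast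
    have oO2: "ortho X w O2" and O2_sub: "O2 \<subseteq> span O1" using O2 by (auto simp: basis_def)
    have O2_span: "span O2 \<subseteq> span O1" using O2_sub by (simp add: span_minimal)
    have finO2: "finite O2" using oO2 by (simp add: ortho_def)
    have "O1 \<subseteq> span O2"
    proof
      fix e assume "e \<in> O1"
      then have e: "e \<in> span O1" by (rule span_base)
      then obtain g where g: "g \<in> span O2" "\<forall>u\<in>X. ev u e = ev u g"
        using O2 wpos by (auto simp: basis_def)
      have "e - g = 0"
        using e g O2_span O1_span by (intro posdef span_diff) (auto simp: ev_diff)
      then show "e \<in> span O2" using g by simp
    qed
    then have \<rho>_le: "\<rho> \<le> card O2"
      unfolding \<rho>_def using independent_span_bound[OF finO2 ortho_independent[OF O1(1)]] by simp
    \<comment> \<open>An element of \<open>span O1\<close> is controlled off \<open>H\<close> by its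
      values on \<open>H\<close>, with total factor \<open>K\<close>. Across the gap the weights
      drop by a factor of at least \<open>2 ^ (\<Gamma> + 1)\<close>, which exceeds
      \<open>2 * K\<close>, so less than half of the norm lies off \<open>H\<close>.\<close>
    have tail: "(\<Sum>u\<in>X - H. w u * (cmod (ev u e))\<^sup>2) < 1 / 2" if e: "e \<in> O2" for e
    proof -
      let ?S = "\<Sum>u\<in>H. (cmod (ev u e))\<^sup>2"
      have S0: "?S \<ge> 0" by (intro sum_nonneg) auto
      have nH: "nsq X (\<lambda>u. if u \<in> H then 1 else 0) e = ?S"
      proof -
        have "nsq X (\<lambda>u. if u \<in> H then 1 else 0) e = (\<Sum>u\<in>X. if u \<in> H then (cmod (ev u e))\<^sup>2 else 0)"
          unfolding nsq_def by (rule sum.cong) auto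
        also have "\<dots> = (\<Sum>u\<in>X \<inter> H. (cmod (ev u e))\<^sup>2)"
          using X by (simp add: sum.inter_restrict)
        also have "X \<inter> H = H" using H by auto
        finally show ?thesis .
      qed
      have one: "nsq X w e = 1"
        using ip_self[of X w e] oO2 e unfolding ortho_def by (metis of_real_1 of_real_eq_iff)
      have "2 ^ ((j + 1) * \<Gamma> + 1) * ?S \<le> (\<Sum>u\<in>H. w u * (cmod (ev u e))\<^sup>2)"
        unfolding sum_distrib_left
      proof (intro sum_mono mult_right_mono)
        fix v assume "v \<in> H"
        then have "(j + 1) * \<Gamma> + 1 \<le> t v" by (auto simp: H_def)
        then show "2 ^ ((j + 1) * \<Gamma> + 1) \<le> w v"
          unfolding w_def wt_def by (intro power_increasing) auto
      qed auto
      also have "\<dots> \<le> nsq X w e"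
        unfolding nsq_def using H X wnn by (intro sum_mono2) auto
      finally have S1: "2 ^ ((j + 1) * \<Gamma> + 1) * ?S \<le> 1" using one by simp
      have "(\<Sum>u\<in>X - H. w u * (cmod (ev u e))\<^sup>2) \<le> (\<Sum>u\<in>X - H. 2 ^ (j * \<Gamma>) * (lev O1 u * ?S))"
      proof (intro sum_mono mult_mono)
        fix v assume v: "v \<in> X - H"
        then show "w v \<le> 2 ^ (j * \<Gamma>)"
          unfolding w_def wt_def using low by (intro power_increasing) auto
        show "(cmod (ev v e))\<^sup>2 \<le> lev O1 v * ?S"
          using ev_sq_le_lev[OF O1(1), of e v] O2_sub e nH by auto
      qed auto
      also have "\<dots> = 2 ^ (j * \<Gamma>) * ?S * (\<Sum>u\<in>X - H. lev O1 u)"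
        unfolding sum_distrib_left[of "2 ^ (j * \<Gamma>) * ?S"]
        by (intro sum.cong refl) (simp only: mult_ac)
      also have "\<dots> \<le> 2 ^ (j * \<Gamma>) * ?S * K"
      proof (intro mult_left_mono)
        have "(\<Sum>u\<in>X - H. lev O1 u) \<le> (\<Sum>u\<in>X. lev O1 u)"
          using X by (intro sum_mono2) (auto simp: lev_nonneg)
        also have "\<dots> \<le> K"
          unfolding K_def O1_def using X H
          by (intro member_le_sum[of H "Pow X" "\<lambda>H. \<Sum>v\<in>X. lev (QH H) v"])
            (auto intro!: sum_nonneg lev_nonneg)
        finally show "(\<Sum>u\<in>X - H. lev O1 u) \<le> K" .
      qed (use S0 in auto)
      finally have le: "(\<Sum>u\<in>X - H. w u * (cmod (ev u e))\<^sup>2) \<le> 2 ^ (j * \<Gamma>) * ?S * K" .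
      show ?thesis
      proof (cases "?S = 0")
        case True
        then show ?thesis using le by simp
      next
        case False
        then have "2 ^ (j * \<Gamma>) * ?S * K < 2 ^ (j * \<Gamma>) * ?S * 2 ^ \<Gamma>"
          using S0 \<Gamma>(1) by (intro mult_strict_left_mono) auto
        also have "\<dots> = (2 ^ ((j + 1) * \<Gamma> + 1) * ?S) / 2"
          by (simp add: power_add algebra_simps)
        also have "\<dots> \<le> 1 / 2" using S1 by simp
        finally show ?thesis using le by linarith
      qed
    qed
    \<comment> \<open>More than \<rho> / 2 of the leverage sits on \<open>H\<close>. But points of
      \<open>H\<close> have \<open>t\<close> positive, hence at most \<alpha> each, and by
      \<open>rank\<close> this totals at most \<rho> / 2.\<close>
    have "real \<rho> / 2 \<le> real (card O2) / 2" using \<rho>_le by simp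
    also have "\<dots> = (\<Sum>e\<in>O2. 1 / 2)" by simp
    also have "\<dots> < (\<Sum>e\<in>O2. \<Sum>u\<in>H. w u * (cmod (ev u e))\<^sup>2)"
    proof (rule sum_strict_mono)
      show "O2 \<noteq> {}" using \<rho>_le \<rho>0 by auto
      fix e assume e: "e \<in> O2"
      have "nsq X w e = 1"
        using ip_self[of X w e] oO2 e unfolding ortho_def by (metis of_real_1 of_real_eq_iff)
      then have "(\<Sum>u\<in>X - H. w u * (cmod (ev u e))\<^sup>2) + (\<Sum>u\<in>H. w u * (cmod (ev u e))\<^sup>2) = 1"
        unfolding nsq_def using sum.subset_diff[OF H(1) X(1)] by metis
      then show "1 / 2 < (\<Sum>u\<in>H. w u * (cmod (ev u e))\<^sup>2)" using tail[OF e] by linarith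
    qed (rule finO2)
    also have "\<dots> = (\<Sum>u\<in>H. w u * lev O2 u)"
      unfolding lev_def sum_distrib_left by (rule sum.swap)
    also have "\<dots> \<le> (\<Sum>u\<in>H. w u * lev (Qt t) u)"
    proof (intro sum_mono mult_left_mono)
      fix v assume "v \<in> H"
      then show "lev O2 v \<le> lev (Qt t) v"
        using H O2_sub O1_span wpos wnn
        by (intro lev_mono[OF bQ _ oO2]) auto
    qed (rule wnn)
    also have "\<dots> \<le> (\<Sum>u\<in>H. \<alpha>)"
      using Pt by (intro sum_mono) (auto simp: P_def w_def H_def)
    also have "\<dots> = real (s * card H) / (2 * real n)" by (simp add: \<alpha>_def)
    also have "\<dots> \<le> real (n * \<rho>) / (2 * real n)"
      using rank n0 by (intro divide_right_mono) (auto simp del: of_nat_mult)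
    also have "\<dots> = real \<rho> / 2" using n0 by simp
    finally show False by simp
  qed
  show ?thesis
  proof (intro exI[of _ w] exI[of _ "Qt t"] conjI ballI)
    fix u assume "u \<in> X"
    then have "\<alpha> / 2 < w u * lev (Qt t) u" using small top by blast
    then show "card B / (4 * card X) \<le> w u * lev (Qt t) u"
      by (simp add: \<alpha>_def n_def s_def)
  qed (use wpos bQ in auto)
qed

end

section \<open>Counting polynomial curves\<close>

interpretation upoly: eval_space smult "\<lambda>i P. poly P (of_nat i :: complex)"
  by unfold_locales (auto simp: smult_add_right smult_add_left)

text \<open>The numbers \<open>\<tau> i\<close> are the leverage scores of the polynomials of degree at most \<open>l\<close>.\<close>

lemma poly_local_leverage:
  fixes w :: "nat \<Rightarrow> real"
  assumes I: "finite I" and w: "\<And>i. i \<in> I \<Longrightarrow> w i > 0"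
  shows "\<exists>\<tau>. (\<forall>i\<in>I. 0 \<le> \<tau> i) \<and> (\<Sum>i\<in>I. \<tau> i) \<le> real l + 1 \<and>
    (\<forall>P. \<forall>i\<in>I. degree P \<le> l \<longrightarrow>
      w i * (cmod (poly P (of_nat i)))\<^sup>2 \<le> \<tau> i * (\<Sum>j\<in>I. w j * (cmod (poly P (of_nat j)))\<^sup>2))"
proof -
  have w0: "0 \<le> w i" if "i \<in> I" for i using w[OF that] by simp
  define M where "M = (\<lambda>k. monom (1 :: complex) k) ` {..l}"
  have M: "finite M" "card M \<le> l + 1"
    unfolding M_def using card_image_le[of "{..l}"] by auto
  obtain Q where Q: "upoly.basis I w M Q"
    using upoly.basis_exists_form[of I w M] I M(1) w0 by blast
  have oQ: "upoly.ortho I w Q" and QM: "Q \<subseteq> upoly.span M"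
    using Q by (auto simp: upoly.basis_def)
  have "card Q \<le> card M"
    using upoly.independent_span_bound[OF M(1) upoly.ortho_independent[OF oQ] QM] by simp
  then have cQ: "card Q \<le> l + 1" using M(2) by linarith
  have in_span: "P \<in> upoly.span M" if "degree P \<le> l" for P
  proof -
    have "P = (\<Sum>k\<le>l. smult (coeff P k) (monom 1 k))"
      using poly_as_sum_of_monoms'[OF that] by (simp add: smult_monom)
    also have "\<dots> \<in> upoly.span M"
      by (intro upoly.span_sum upoly.span_scale upoly.span_base) (auto simp: M_def)
    finally show ?thesis .
  qed
  show ?thesis
  proof (intro exI[of _ "\<lambda>i. w i * upoly.lev Q i"] conjI allI ballI impI)
    fix P :: "complex poly" and i assume "i \<in> I" "degree P \<le> l"
    then have "(cmod (poly P (of_nat i)))\<^sup>2 \<le> upoly.lev Q i * upoly.nsq I w P"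
      using upoly.ev_sq_le_lev_basis[of I w M Q P i] Q w0 in_span w by blast
    then show "w i * (cmod (poly P (of_nat i)))\<^sup>2
        \<le> w i * upoly.lev Q i * (\<Sum>j\<in>I. w j * (cmod (poly P (of_nat j)))\<^sup>2)"
      using w[OF \<open>i \<in> I\<close>] by (simp add: upoly.nsq_def mult.assoc)
  qed (use w cQ upoly.sum_lev[OF oQ] in \<open>auto simp: upoly.lev_nonneg less_imp_le\<close>)
qed

context eval_space
begin

definition poly_curve :: "nat \<Rightarrow> nat \<Rightarrow> (nat \<Rightarrow> 'a) \<Rightarrow> bool" where
  "poly_curve l r p \<longleftrightarrow> inj_on p {..<r} \<and>
     (\<forall>f. \<exists>P. degree P \<le> l \<and> (\<forall>i<r. ev (p i) f = poly P (of_nat i)))"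

text \<open>Squared entries of the kernel matrix after symmetric weighting. For orthonormal
  \<open>Q\<close> that matrix is a projection, so its squared Hilbert-Schmidt norm is its
  rank.\<close>

definition energy :: "('a \<Rightarrow> real) \<Rightarrow> 'v set \<Rightarrow> 'a \<Rightarrow> 'a \<Rightarrow> real" where
  "energy w Q u v = w u * w v * (cmod (ev v (ker_vec Q u)))\<^sup>2"

lemma energy_nonneg: "0 \<le> w u \<Longrightarrow> 0 \<le> w v \<Longrightarrow> 0 \<le> energy w Q u v"
  by (simp add: energy_def)

lemma sum_energy:
  assumes "ortho X w Q"
  shows "(\<Sum>u\<in>X. \<Sum>v\<in>X. energy w Q u v) = card Q"
proof -
  have "(\<Sum>v\<in>X. energy w Q u v) = w u * lev Q u" for u
    using nsq_ker_vec[OF assms, of u]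
    by (simp add: energy_def nsq_def mult.assoc flip: sum_distrib_left)
  then show ?thesis using sum_lev[OF assms] by simp
qed

text \<open>
  The kernel at a point of the curve restricts to a polynomial of degree \<open>l\<close>, which cannot be
  concentrated at that point unless the local leverage score there exceeds \<open>1/2\<close>; the latter
  happens at most \<open>2(l+1)\<close> times.
\<close>

lemma curve_energy:
  assumes curve: "poly_curve l r p"
    and w: "\<And>u. u \<in> X \<Longrightarrow> w u > 0" and \<alpha>: "0 \<le> \<alpha>" "\<And>u. u \<in> X \<Longrightarrow> \<alpha> \<le> w u * lev Q u"
  defines "I \<equiv> {i. i < r \<and> p i \<in> X}"
  shows "(real (card I) - 2 * (real l + 1)) * \<alpha>\<^sup>2 \<le> (\<Sum>i\<in>I. \<Sum>j\<in>I - {i}. energy w Q (p i) (p j))"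
proof -
  have finI: "finite I" by (simp add: I_def)
  have wp: "w (p i) > 0" if "i \<in> I" for i using w that by (auto simp: I_def)
  obtain \<tau> :: "nat \<Rightarrow> real" where \<tau>: "\<And>i. i \<in> I \<Longrightarrow> \<tau> i \<ge> 0" "(\<Sum>i\<in>I. \<tau> i) \<le> real l + 1"
    and \<tau>_le: "\<And>P i. degree P \<le> l \<Longrightarrow> i \<in> I \<Longrightarrow> w (p i) * (cmod (poly P (of_nat i)))\<^sup>2
        \<le> \<tau> i * (\<Sum>j\<in>I. w (p j) * (cmod (poly P (of_nat j)))\<^sup>2)"
    using poly_local_leverage[of I "\<lambda>i. w (p i)" l] finI wp by blast
  have en_nonneg: "0 \<le> energy w Q (p i) (p j)" if "i \<in> I" "j \<in> I" for i j
    using wp that by (intro energy_nonneg) (auto intro: less_imp_le)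
  \<comment> \<open>With \<open>?L\<close> the weighted leverage and \<open>?S\<close> the
    off-diagonal sum, local leverage gives
    \<open>?L\<^sup>2 \<le> \<tau> i * (?L\<^sup>2 + ?S)\<close>. This is weakened to a bound linear
    in \<open>\<tau> i\<close>, so that only the sum of the \<tau> enters at the end.\<close>
  have pt: "(1 - 2 * \<tau> i) * \<alpha>\<^sup>2 \<le> (\<Sum>j\<in>I - {i}. energy w Q (p i) (p j))" if i: "i \<in> I" for i
  proof (cases "\<tau> i \<le> 1 / 2")
    case False
    then have "(1 - 2 * \<tau> i) * \<alpha>\<^sup>2 \<le> 0" by (intro mult_nonpos_nonneg) auto
    also have "0 \<le> (\<Sum>j\<in>I - {i}. energy w Q (p i) (p j))"
      using i en_nonneg by (intro sum_nonneg) auto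
    finally show ?thesis .
  next
    case True
    let ?u = "p i" let ?S = "\<Sum>j\<in>I - {i}. energy w Q (p i) (p j)"
    let ?L = "w ?u * lev Q ?u"
    obtain P where P: "degree P \<le> l" "\<And>j. j < r \<Longrightarrow> ev (p j) (ker_vec Q ?u) = poly P (of_nat j)"
      using curve unfolding poly_curve_def by blast
    have self: "energy w Q ?u ?u = ?L\<^sup>2"
      by (simp add: energy_def ev_ker_vec_self power2_eq_square)
    have "?L\<^sup>2 = w ?u * (w ?u * (cmod (poly P (of_nat i)))\<^sup>2)"
      using P(2)[of i] i self by (simp add: I_def energy_def)
    also have "\<dots> \<le> w ?u * (\<tau> i * (\<Sum>j\<in>I. w (p j) * (cmod (poly P (of_nat j)))\<^sup>2))"
      using \<tau>_le[OF P(1) i] wp[OF i] by simp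
    also have "(\<Sum>j\<in>I. w (p j) * (cmod (poly P (of_nat j)))\<^sup>2)
        = (\<Sum>j\<in>I. w (p j) * (cmod (ev (p j) (ker_vec Q ?u)))\<^sup>2)"
      using P(2) by (intro sum.cong) (auto simp: I_def)
    also have "w ?u * (\<tau> i * \<dots>) = \<tau> i * (\<Sum>j\<in>I. energy w Q ?u (p j))"
      by (simp add: energy_def sum_distrib_left mult_ac)
    also have "(\<Sum>j\<in>I. energy w Q ?u (p j)) = ?L\<^sup>2 + ?S"
      using finI i self by (simp add: sum.remove)
    finally have "(1 - \<tau> i) * ?L\<^sup>2 \<le> \<tau> i * ?S" by (simp add: algebra_simps)
    moreover have "(1 - 2 * \<tau> i) * ?L\<^sup>2 \<le> (1 - \<tau> i) * ?L\<^sup>2"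
      using \<tau>(1)[of i] i by (intro mult_right_mono) auto
    moreover have "0 \<le> ?S" using i en_nonneg by (intro sum_nonneg) auto
    then have "\<tau> i * ?S \<le> ?S"
      using True \<tau>(1)[of i] i by (intro mult_left_le_one_le) auto
    ultimately have "(1 - 2 * \<tau> i) * ?L\<^sup>2 \<le> ?S" by linarith
    moreover have "\<alpha>\<^sup>2 \<le> ?L\<^sup>2"
      using \<alpha> i by (intro power_mono) (auto simp: I_def)
    then have "(1 - 2 * \<tau> i) * \<alpha>\<^sup>2 \<le> (1 - 2 * \<tau> i) * ?L\<^sup>2"
      using True by (intro mult_left_mono) auto
    ultimately show ?thesis by linarith
  qed
  have "(real (card I) - 2 * (real l + 1)) * \<alpha>\<^sup>2 \<le> (\<Sum>i\<in>I. 1 - 2 * \<tau> i) * \<alpha>\<^sup>2"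
    using \<tau>(2) by (intro mult_right_mono) (auto simp: sum_subtractf simp flip: sum_distrib_left)
  also have "\<dots> \<le> (\<Sum>i\<in>I. \<Sum>j\<in>I - {i}. energy w Q (p i) (p j))"
    unfolding sum_distrib_right by (intro sum_mono pt)
  finally show ?thesis .
qed

text \<open>A double count of the energy between distinct points of a curve. Each curve receives at
  least \<open>r / 4 * \<alpha>\<^sup>2\<close>. For fixed distinct positions an ordered pair of
  points belongs to at most one curve, so each of the \<open>r\<^sup>2\<close> pairs of positions
  accounts for at most the total energy. As \<alpha> is \<open>card B / (4 * card X)\<close>, the
  constant is 4 * 16 = 64.\<close>

lemma curve_count:
  fixes p :: "'c \<Rightarrow> nat \<Rightarrow> 'a"
  assumes Y: "finite Y" and B: "finite B" "independent B" "B \<noteq> {}"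
  defines "X \<equiv> {u \<in> Y. \<exists>f\<in>B. ev u f \<noteq> 0}"
  assumes semi: "\<And>B'. B' \<subseteq> span B \<Longrightarrow> independent B' \<Longrightarrow> B' \<noteq> {} \<Longrightarrow>
      card X * card B' \<le> card B * card {u \<in> Y. \<exists>f\<in>B'. ev u f \<noteq> 0}"
    and C: "finite C" "\<And>c. c \<in> C \<Longrightarrow> poly_curve l r (p c)"
      "\<And>c i. c \<in> C \<Longrightarrow> i < r \<Longrightarrow> p c i \<in> Y"
      "\<And>c. c \<in> C \<Longrightarrow> \<exists>i<r. p c i \<in> X"
    and inj: "\<And>i j. i < r \<Longrightarrow> j < r \<Longrightarrow> i \<noteq> j \<Longrightarrow> inj_on (\<lambda>c. (p c i, p c j)) C"
    and r: "4 * (l + 1) \<le> r"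
  shows "card C * card B \<le> 64 * r * (card X)\<^sup>2"
proof (cases "C = {}")
  case True
  then show ?thesis by simp
next
  case False
  then have X: "finite X" "X \<noteq> {}" using Y C(4) by (auto simp: X_def)
  have supp: "{u \<in> Y. \<exists>f\<in>B'. ev u f \<noteq> 0} = {u \<in> X. \<exists>f\<in>B'. ev u f \<noteq> 0}"
    if "B' \<subseteq> span B" for B'
  proof -
    have "u \<in> X" if u: "u \<in> Y" "f \<in> B'" "ev u f \<noteq> 0" for u f
    proof (rule ccontr)
      assume "u \<notin> X"
      then have "B \<subseteq> {f. ev u f = 0}" using u by (auto simp: X_def)
      moreover have "subspace {f. ev u f = 0}"
        by (rule subspaceI) (auto simp: ev_add ev_scale)
      ultimately have "span B \<subseteq> {f. ev u f = 0}" by (rule span_minimal)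
      then show False using u \<open>B' \<subseteq> span B\<close> by blast
    qed
    then show ?thesis by (auto simp: X_def)
  qed
  have "\<exists>w Q. (\<forall>u\<in>X. w u > 0) \<and> basis X w B Q \<and>
    (\<forall>u\<in>X. card B / (4 * card X) \<le> w u * lev Q u)"
  proof (rule leverage_weights[OF X B(1) _ B(2,3)])
    fix B' assume "B' \<subseteq> span B" "independent B'" "B' \<noteq> {}"
    then show "card X * card B' \<le> card B * card {u \<in> X. \<exists>f\<in>B'. ev u f \<noteq> 0}"
      using semi[of B'] supp[of B'] by simp
  qed
  then obtain w Q where w: "\<And>u. u \<in> X \<Longrightarrow> w u > 0" and bQ: "basis X w B Q"
    and lv: "\<And>u. u \<in> X \<Longrightarrow> card B / (4 * card X) \<le> w u * lev Q u"
    by blast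
  have oQ: "ortho X w Q" and QB: "Q \<subseteq> span B" using bQ by (auto simp: basis_def)
  have cQ: "card Q \<le> card B"
    using independent_span_bound[OF B(1) ortho_independent[OF oQ] QB] by simp
  define n where "n = real (card X)"
  define s where "s = real (card B)"
  define \<alpha> where "\<alpha> = s / (4 * n)"
  have n0: "n > 0" using X by (simp add: n_def card_gt_0_iff)
  have s0: "s > 0" using B by (simp add: s_def card_gt_0_iff)
  define I where "I c = {i. i < r \<and> p c i \<in> X}" for c
  let ?q = "energy w Q"
  have q0: "0 \<le> ?q u v" if "u \<in> X" "v \<in> X" for u v
    using that w less_imp_le by (intro energy_nonneg) auto
  \<comment> \<open>Some \<open>f\<close> in \<open>B\<close> is nonzero at a point of the curve.
    Its restriction is a nonzero polynomial of degree at most \<open>l\<close>, which vanishes at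
    every index where the curve is off \<open>X\<close>.\<close>
  have cI: "real (card (I c)) \<ge> real r - real l" if c: "c \<in> C" for c
  proof (rule ccontr)
    assume less: "\<not> real (card (I c)) \<ge> real r - real l"
    let ?J = "{..<r} - I c"
    have "card ?J = r - card (I c)"
      by (subst card_Diff_subset) (auto simp: I_def)
    then have cJ: "card ?J > l" using less r by linarith
    obtain i where i: "i < r" "p c i \<in> X" using C(4)[OF c] by blast
    then obtain f where f: "f \<in> B" "ev (p c i) f \<noteq> 0" by (auto simp: X_def)
    obtain P where P: "degree P \<le> l" "\<And>j. j < r \<Longrightarrow> ev (p c j) f = poly P (of_nat j)"
      using C(2)[OF c] unfolding poly_curve_def by blast
    have "P \<noteq> 0" using f P(2)[OF i(1)] by auto
    have "of_nat ` ?J \<subseteq> {z. poly P z = 0}"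
    proof clarify
      fix j assume "j < r" "j \<notin> I c"
      then have "ev (p c j) f = 0" using C(3)[OF c] f(1) by (auto simp: I_def X_def)
      then show "poly P (of_nat j) = 0" using P(2)[OF \<open>j < r\<close>] by simp
    qed
    then have "card (of_nat ` ?J :: complex set) \<le> card {z. poly P z = 0}"
      using poly_roots_finite[OF \<open>P \<noteq> 0\<close>] by (intro card_mono) auto
    also have "\<dots> \<le> degree P" using \<open>P \<noteq> 0\<close> by (rule card_poly_roots_bound)
    finally show False using cJ P(1) by (simp add: card_image inj_on_def)
  qed
  have "real (card C) * (real r / 4 * \<alpha>\<^sup>2) = (\<Sum>c\<in>C. real r / 4 * \<alpha>\<^sup>2)" by simp
  also have "\<dots> \<le> (\<Sum>c\<in>C. \<Sum>i\<in>I c. \<Sum>j\<in>I c - {i}. ?q (p c i) (p c j))"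
  proof (rule sum_mono)
    fix c assume c: "c \<in> C"
    \<comment> \<open>From 4 (l + 1) \<le> r follows (r - l) - 2 (l + 1) \<ge> r / 4.\<close>
    have "real r / 4 * \<alpha>\<^sup>2 \<le> (real (card (I c)) - 2 * (real l + 1)) * \<alpha>\<^sup>2"
      using cI[OF c] r by (intro mult_right_mono) auto
    also have "\<dots> \<le> (\<Sum>i\<in>I c. \<Sum>j\<in>I c - {i}. ?q (p c i) (p c j))"
      unfolding I_def using lv n0 s0
      by (intro curve_energy[OF C(2)[OF c]]) (auto simp: \<alpha>_def n_def s_def w)
    finally show "real r / 4 * \<alpha>\<^sup>2 \<le> (\<Sum>i\<in>I c. \<Sum>j\<in>I c - {i}. ?q (p c i) (p c j))" .
  qed
  also have "\<dots> = (\<Sum>c\<in>C. \<Sum>i<r. \<Sum>j<r.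
      if i \<noteq> j \<and> p c i \<in> X \<and> p c j \<in> X then ?q (p c i) (p c j) else 0)"
  proof (rule sum.cong[OF refl])
    fix c
    have inner: "(\<Sum>j\<in>I c - {i}. ?q (p c i) (p c j)) = (\<Sum>j<r.
        if i \<noteq> j \<and> p c i \<in> X \<and> p c j \<in> X then ?q (p c i) (p c j) else 0)" if "i \<in> I c" for i
      using that by (intro sum.mono_neutral_cong_left) (auto simp: I_def)
    have "(\<Sum>i\<in>I c. \<Sum>j\<in>I c - {i}. ?q (p c i) (p c j)) = (\<Sum>i\<in>I c. \<Sum>j<r.
        if i \<noteq> j \<and> p c i \<in> X \<and> p c j \<in> X then ?q (p c i) (p c j) else 0)"
      by (intro sum.cong refl inner)
    also have "\<dots> = (\<Sum>i<r. \<Sum>j<r.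
        if i \<noteq> j \<and> p c i \<in> X \<and> p c j \<in> X then ?q (p c i) (p c j) else 0)"
      by (intro sum.mono_neutral_left) (auto simp: I_def)
    finally show "(\<Sum>i\<in>I c. \<Sum>j\<in>I c - {i}. ?q (p c i) (p c j)) = \<dots>" .
  qed
  also have "\<dots> = (\<Sum>i<r. \<Sum>j<r. \<Sum>c\<in>C.
      if i \<noteq> j \<and> p c i \<in> X \<and> p c j \<in> X then ?q (p c i) (p c j) else 0)"
    by (subst sum.swap) (intro sum.cong refl sum.swap)
  also have "\<dots> \<le> (\<Sum>i<r. \<Sum>j<r. s)"
  proof (intro sum_mono)
    fix i j assume ij: "i \<in> {..<r}" "j \<in> {..<r}"
    show "(\<Sum>c\<in>C. if i \<noteq> j \<and> p c i \<in> X \<and> p c j \<in> X then ?q (p c i) (p c j) else 0) \<le> s"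
    proof (cases "i = j")
      case True
      then show ?thesis using s0 by simp
    next
      case False
      let ?C = "{c \<in> C. p c i \<in> X \<and> p c j \<in> X}" let ?h = "\<lambda>c. (p c i, p c j)"
      have "(\<Sum>c\<in>C. if i \<noteq> j \<and> p c i \<in> X \<and> p c j \<in> X then ?q (p c i) (p c j) else 0)
          = (\<Sum>c\<in>?C. ?q (p c i) (p c j))"
        using False C(1) by (simp add: sum.inter_filter)
      also have "\<dots> = (\<Sum>(u, v)\<in>?h ` ?C. ?q u v)"
        using inj[of i j] ij False by (subst sum.reindex) (auto intro: inj_on_subset)
      also have "\<dots> \<le> (\<Sum>(u, v)\<in>X \<times> X. ?q u v)"
        using X q0 by (intro sum_mono2) auto
      also have "\<dots> = card Q"
        using sum_energy[OF oQ] X by (simp add: sum.cartesian_product)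
      finally show ?thesis using cQ by (simp add: s_def)
    qed
  qed
  also have "\<dots> = (real r)\<^sup>2 * s" by (simp add: power2_eq_square)
  finally have "real (card C) * (real r / 4 * \<alpha>\<^sup>2) \<le> (real r)\<^sup>2 * s" .
  moreover have "real (card C) * (real r / 4 * \<alpha>\<^sup>2)
      = (real (card C) * s) * (real r * s) / (64 * n\<^sup>2)"
    by (simp add: \<alpha>_def power2_eq_square)
  ultimately have "(real (card C) * s) * (real r * s) \<le> (64 * real r * n\<^sup>2) * (real r * s)"
    using n0 by (simp add: pos_divide_le_eq power2_eq_square mult_ac)
  then have "real (card C) * s \<le> 64 * real r * n\<^sup>2"
    using s0 r by (simp add: mult_le_cancel_right)
  then have "real (card C * card B) \<le> real (64 * r * (card X)\<^sup>2)"
    by (simp add: s_def n_def)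
  then show ?thesis by (simp only: of_nat_le_iff)
qed

end

section \<open>Polynomials in several variables\<close>

definition cscale :: "complex \<Rightarrow> ('i \<Rightarrow> complex) \<Rightarrow> 'i \<Rightarrow> complex" where
  "cscale a c = (\<lambda>e. a * c e)"

text \<open>Bounding each exponent separately gives dimension \<open>(d + 1) ^ card J\<close>, while
  the total degree is still at most \<open>card J * d\<close>. Extensional functions keep the box
  finite over an infinite index type.\<close>

definition ebox :: "'i set \<Rightarrow> nat \<Rightarrow> ('i \<Rightarrow> nat) set" where
  "ebox J d = J \<rightarrow>\<^sub>E {..d}"

text \<open>
  A polynomial in the variables \<open>J\<close> is given by its coefficients, a function on exponents;
  only the exponents in the box \<open>{0..d}\<^sup>J\<close> matter.
\<close>

definition mev :: "'i set \<Rightarrow> nat \<Rightarrow> ('i \<Rightarrow> complex) \<Rightarrow> (('i \<Rightarrow> nat) \<Rightarrow> complex) \<Rightarrow> complex" where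
  "mev J d z c = (\<Sum>e\<in>ebox J d. c e * (\<Prod>j\<in>J. z j ^ e j))"

interpretation mpoly: eval_space cscale "mev J d" for J :: "'i set" and d
  by unfold_locales
    (auto simp: cscale_def mev_def algebra_simps sum.distrib sum_distrib_left fun_eq_iff)

lemma finite_ebox: "finite J \<Longrightarrow> finite (ebox J d)"
  by (simp add: ebox_def finite_PiE)

lemma card_ebox: "finite J \<Longrightarrow> card (ebox J d) = (d + 1) ^ card J"
  by (simp add: ebox_def card_PiE)

section \<open>Restriction of a polynomial to a line\<close>

definition pt :: "('i \<Rightarrow> complex) \<Rightarrow> ('i \<Rightarrow> complex) \<Rightarrow> complex \<Rightarrow> 'i \<Rightarrow> complex" where
  "pt y x s = (\<lambda>j. y j + s * x j)"

lemma pt_eqD: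
  assumes "pt y x s = pt y' x' s" "pt y x t = pt y' x' t" "s \<noteq> t"
  shows "y = y' \<and> x = x'"
proof -
  have x: "x j = x' j" for j
  proof -
    have "y j + s * x j = y' j + s * x' j" "y j + t * x j = y' j + t * x' j"
      using assms(1,2) by (auto simp: pt_def fun_eq_iff)
    then have "(s - t) * x j = (s - t) * x' j" by (simp add: algebra_simps) algebra
    then show ?thesis using assms(3) by simp
  qed
  moreover have "y j = y' j" for j
    using fun_cong[OF assms(1), of j] x by (simp add: pt_def)
  ultimately show ?thesis by auto
qed

lemma pt_inj: "x \<noteq> 0 \<Longrightarrow> pt y x s = pt y x t \<longleftrightarrow> s = t"
  by (auto simp: pt_def fun_eq_iff)

definition line_poly ::
  "'i set \<Rightarrow> nat \<Rightarrow> ('i \<Rightarrow> complex) \<Rightarrow> ('i \<Rightarrow> complex) \<Rightarrow> (('i \<Rightarrow> nat) \<Rightarrow> complex) \<Rightarrow> complex poly" where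
  "line_poly J d y x c = (\<Sum>e\<in>ebox J d. smult (c e) (\<Prod>j\<in>J. [:y j, x j:] ^ e j))"

lemma poly_line_poly: "poly (line_poly J d y x c) s = mev J d (pt y x s) c"
  by (simp add: line_poly_def mev_def poly_sum poly_prod pt_def)

lemma degree_line_poly:
  assumes "finite J"
  shows "degree (line_poly J d y x c) \<le> card J * d"
  unfolding line_poly_def
proof (rule degree_sum_le[OF finite_ebox[OF assms]])
  fix e assume e: "e \<in> ebox J d"
  have "degree (smult (c e) (\<Prod>j\<in>J. [:y j, x j:] ^ e j)) \<le> degree (\<Prod>j\<in>J. [:y j, x j:] ^ e j)"
    by (rule degree_smult_le)
  also have "\<dots> \<le> (\<Sum>j\<in>J. degree ([:y j, x j:] ^ e j))"
    by (rule order_trans[OF degree_prod_sum_le[OF assms]]) (simp add: o_def)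
  also have "\<dots> \<le> (\<Sum>j\<in>J. d)"
  proof (rule sum_mono)
    fix j assume "j \<in> J"
    have "degree ([:y j, x j:] ^ e j) \<le> degree [:y j, x j:] * e j" by (rule degree_power_le)
    also have "\<dots> \<le> 1 * d"
      using e \<open>j \<in> J\<close> by (intro mult_mono) (auto simp: ebox_def)
    finally show "degree ([:y j, x j:] ^ e j) \<le> d" by simp
  qed
  finally show "degree (smult (c e) (\<Prod>j\<in>J. [:y j, x j:] ^ e j)) \<le> card J * d" by simp
qed

section \<open>Gradients and formal derivatives\<close>

text \<open>The truncated \<open>e j - 1\<close> is harmless at \<open>e j = 0\<close> because of
  the factor \<open>e j\<close>.\<close>

definition mgrad :: "'i set \<Rightarrow> nat \<Rightarrow> ('i \<Rightarrow> complex) \<Rightarrow> (('i \<Rightarrow> nat) \<Rightarrow> complex) \<Rightarrow> 'i \<Rightarrow> complex" where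
  "mgrad J d z c j =
     (\<Sum>e\<in>ebox J d. c e * (of_nat (e j) * z j ^ (e j - 1) * (\<Prod>i\<in>J - {j}. z i ^ e i)))"

lemma pderiv_line_poly: "poly (pderiv (line_poly J d y x c)) 0 = (\<Sum>j\<in>J. mgrad J d y c j * x j)"
proof -
  have "poly (pderiv (line_poly J d y x c)) 0 = (\<Sum>e\<in>ebox J d. c e * (\<Sum>j\<in>J.
      (\<Prod>i\<in>J - {j}. y i ^ e i) * (of_nat (e j) * y j ^ (e j - 1) * x j)))"
    by (simp add: line_poly_def higher_pderiv_sum[of 1, simplified] pderiv_smult pderiv_prod pderiv_power
        pderiv_pCons poly_sum poly_prod mult_ac)
  also have "\<dots> = (\<Sum>j\<in>J. \<Sum>e\<in>ebox J d. c e *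
      ((\<Prod>i\<in>J - {j}. y i ^ e i) * (of_nat (e j) * y j ^ (e j - 1) * x j)))"
    unfolding sum_distrib_left by (rule sum.swap)
  also have "\<dots> = (\<Sum>j\<in>J. mgrad J d y c j * x j)"
    unfolding mgrad_def sum_distrib_right by (intro sum.cong refl) (simp add: mult_ac)
  finally show ?thesis .
qed

text \<open>Coefficients of the partial derivative in the variable \<open>j\<close>. They are set to
  zero off the box so that differentiation can be iterated.\<close>

definition dcoef :: "'i set \<Rightarrow> nat \<Rightarrow> 'i \<Rightarrow> (('i \<Rightarrow> nat) \<Rightarrow> complex) \<Rightarrow> ('i \<Rightarrow> nat) \<Rightarrow> complex" where
  "dcoef J d j c e =
     (if e \<in> ebox J d \<and> e j < d then of_nat (e j + 1) * c (e(j := e j + 1)) else 0)"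

lemma ebox_upd: "e \<in> ebox J d \<Longrightarrow> j \<in> J \<Longrightarrow> k \<le> d \<Longrightarrow> e(j := k) \<in> ebox J d"
  by (auto simp: ebox_def PiE_def extensional_def)

lemma mgrad_eq_mev:
  assumes J: "finite J" "j \<in> J"
  shows "mgrad J d z c j = mev J d z (dcoef J d j c)"
proof -
  have "mgrad J d z c j = (\<Sum>e\<in>{e \<in> ebox J d. e j > 0}.
      c e * (of_nat (e j) * z j ^ (e j - 1) * (\<Prod>i\<in>J - {j}. z i ^ e i)))"
    unfolding mgrad_def using finite_ebox[OF J(1)] by (intro sum.mono_neutral_right) auto
  also have "\<dots> = (\<Sum>e\<in>{e \<in> ebox J d. e j < d}.
      of_nat (e j + 1) * c (e(j := e j + 1)) * (\<Prod>i\<in>J. z i ^ e i))"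
  proof (rule sum.reindex_bij_witness[of _ "\<lambda>e. e(j := e j + 1)" "\<lambda>e. e(j := e j - 1)"])
    fix e assume e: "e \<in> {e \<in> ebox J d. e j > 0}"
    then have le: "e j \<le> d" using J(2) by (auto simp: ebox_def)
    show "(e(j := e j - 1))(j := (e(j := e j - 1)) j + 1) = e" using e by auto
    show "e(j := e j - 1) \<in> {e \<in> ebox J d. e j < d}"
      using e le J(2) by (auto intro!: ebox_upd)
    have "(\<Prod>i\<in>J. z i ^ (e(j := e j - 1)) i) = z j ^ (e j - 1) * (\<Prod>i\<in>J - {j}. z i ^ e i)"
      using J by (simp add: prod.remove)
    then show "of_nat ((e(j := e j - 1)) j + 1) * c ((e(j := e j - 1))(j := (e(j := e j - 1)) j + 1))
        * (\<Prod>i\<in>J. z i ^ (e(j := e j - 1)) i)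
        = c e * (of_nat (e j) * z j ^ (e j - 1) * (\<Prod>i\<in>J - {j}. z i ^ e i))"
      using e by (simp add: mult_ac)
  next
    fix e assume e: "e \<in> {e \<in> ebox J d. e j < d}"
    show "(e(j := e j + 1))(j := (e(j := e j + 1)) j - 1) = e" by auto
    show "e(j := e j + 1) \<in> {e \<in> ebox J d. e j > 0}"
      using e J(2) by (auto intro!: ebox_upd)
  qed
  also have "\<dots> = mev J d z (dcoef J d j c)"
    unfolding mev_def using finite_ebox[OF J(1)]
    by (intro sum.mono_neutral_cong_left) (auto simp: dcoef_def)
  finally show ?thesis .
qed

text \<open>If all partial derivatives of \<open>c\<close> vanish on \<open>X\<close>, a nonzero one
  of them replaces \<open>c\<close>. The total degree drops, and the descent must stop before
  reaching a constant, since a nonzero constant does not vanish on \<open>X\<close>.\<close>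

lemma exists_nonzero_gradient:
  assumes J: "finite J" and X: "X \<noteq> {}"
    and c: "c \<noteq> 0" "\<And>e. e \<notin> ebox J d \<Longrightarrow> c e = 0" "\<And>u. u \<in> X \<Longrightarrow> mev J d u c = 0"
  shows "\<exists>c'. \<exists>u\<in>X. \<exists>j\<in>J. (\<forall>z\<in>X. mev J d z c' = 0) \<and> mgrad J d u c' j \<noteq> 0"
proof -
  have "\<exists>c'. \<exists>u\<in>X. \<exists>j\<in>J. (\<forall>z\<in>X. mev J d z c' = 0) \<and> mgrad J d u c' j \<noteq> 0"
    if "c \<noteq> 0" "\<And>e. e \<notin> ebox J d \<Longrightarrow> c e = 0" "\<And>u. u \<in> X \<Longrightarrow> mev J d u c = 0"
      "\<And>e. c e \<noteq> 0 \<Longrightarrow> (\<Sum>j\<in>J. e j) < N" for c N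
    using that
  proof (induction N arbitrary: c)
    case 0
    have "\<exists>e. c e \<noteq> 0"
    proof (rule ccontr)
      assume "\<nexists>e. c e \<noteq> 0"
      then have "c = 0" by (intro ext) simp
      then show False using 0(1) by contradiction
    qed
    then obtain e where "c e \<noteq> 0" ..
    then have "(\<Sum>j\<in>J. e j) < 0" by (rule 0(4))
    then show ?case by (rule less_zeroE)
  next
    case (Suc N)
    show ?case
    proof (cases "\<exists>u\<in>X. \<exists>j\<in>J. mgrad J d u c j \<noteq> 0")
      case True
      then obtain u j where "u \<in> X" "j \<in> J" "mgrad J d u c j \<noteq> 0" by blast
      then show ?thesis
        using Suc.prems(3) by (intro exI[of _ c] bexI[of _ u] bexI[of _ j] conjI ballI) auto
    next
      case False
      have vanish: "mev J d u (dcoef J d j c) = 0" if "u \<in> X" "j \<in> J" for u j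
        using False that mgrad_eq_mev[OF J] by metis
      obtain e where e: "c e \<noteq> 0" using Suc.prems(1) by (auto simp: fun_eq_iff)
      then have eb: "e \<in> ebox J d" using Suc.prems(2) by blast
      show ?thesis
      proof (cases "\<exists>e j. c e \<noteq> 0 \<and> j \<in> J \<and> e j > 0")
        case True
        then obtain e j where ej: "c e \<noteq> 0" "j \<in> J" "e j > 0" by blast
        then have eb: "e \<in> ebox J d" using Suc.prems(2) by blast
        then have "e j \<le> d" using ej(2) by (auto simp: ebox_def)
        then have "dcoef J d j c (e(j := e j - 1)) = of_nat (e j) * c e"
          using ej eb by (auto simp: dcoef_def intro!: ebox_upd)
        then have nz: "dcoef J d j c \<noteq> 0" using ej by (intro notI) simp
        show ?thesis
        proof (rule Suc.IH[of "dcoef J d j c"])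
          show "dcoef J d j c \<noteq> 0" by (rule nz)
          show "dcoef J d j c e' = 0" if "e' \<notin> ebox J d" for e'
            using that by (simp add: dcoef_def)
          show "mev J d u (dcoef J d j c) = 0" if "u \<in> X" for u
            using vanish[OF that ej(2)] .
          show "(\<Sum>i\<in>J. e' i) < N" if "dcoef J d j c e' \<noteq> 0" for e'
          proof -
            have "c (e'(j := e' j + 1)) \<noteq> 0" using that by (auto simp: dcoef_def split: if_splits)
            then have "(\<Sum>i\<in>J. (e'(j := e' j + 1)) i) < Suc N" by (rule Suc.prems(4))
            moreover have "(\<Sum>i\<in>J. (e'(j := e' j + 1)) i) = (\<Sum>i\<in>J. e' i) + 1"
              using J ej(2) by (simp add: sum.remove)
            ultimately show ?thesis by simp
          qed
        qed
      next
        case False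
        have zero: "e' j = 0" if "c e' \<noteq> 0" "j \<in> J" for e' j
        proof (rule ccontr)
          assume "e' j \<noteq> 0"
          then have "e' j > 0" by simp
          then show False using False that by blast
        qed
        \<comment> \<open>Exponents in the box are extensional, so being zero on \<open>J\<close>
          determines them; \<open>c\<close> is a nonzero constant polynomial.\<close>
        have uniq: "e' = e" if "c e' \<noteq> 0" for e'
        proof
          fix i
          show "e' i = e i"
          proof (cases "i \<in> J")
            case True
            then show ?thesis using zero[OF that True] zero[OF e True] by simp
          next
            case False
            then show ?thesis
              using eb Suc.prems(2)[of e'] that by (auto simp: ebox_def PiE_def extensional_def)
          qed
        qed
        obtain u where u: "u \<in> X" using X by blast
        have "mev J d u c = (\<Sum>e'\<in>{e}. c e' * (\<Prod>j\<in>J. u j ^ e' j))"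
          unfolding mev_def using eb finite_ebox[OF J] uniq
          by (intro sum.mono_neutral_right) auto
        also have "\<dots> = c e" using zero[OF e] by simp
        finally show ?thesis using e Suc.prems(3)[OF u] by simp
      qed
    qed
  qed
  moreover have "(\<Sum>j\<in>J. e j) < card J * d + 1" if "c e \<noteq> 0" for e
  proof -
    from that
    have "e \<in> ebox J d" using c(2) by blast
    then have "(\<Sum>j\<in>J. e j) \<le> (\<Sum>j\<in>J. d)" by (intro sum_mono) (auto simp: ebox_def)
    then show ?thesis by simp
  qed
  ultimately show ?thesis using c by blast
qed

section \<open>Progressions and hyperplanes\<close>

text \<open>Progressions are parametrised here, so a progression and its reversal are two elements.
  This is harmless because the number of set progressions is only needed as a lower bound. Excluding
  \<open>x = 0\<close> makes the points distinct.\<close>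

definition progs :: "nat \<Rightarrow> ('i \<Rightarrow> complex) set \<Rightarrow> (('i \<Rightarrow> complex) \<times> ('i \<Rightarrow> complex)) set" where
  "progs r X = {(y, x). x \<noteq> 0 \<and> (\<forall>k<r. pt y x (of_nat k) \<in> X)}"

lemma progs_mono: "X \<subseteq> Y \<Longrightarrow> progs r X \<subseteq> progs r Y"
  by (auto simp: progs_def)

lemma inj_on_progs:
  assumes "i \<noteq> j"
  shows "inj_on (\<lambda>(y, x). (pt y x (of_nat i), pt y x (of_nat j))) A"
  using assms by (auto simp: inj_on_def dest: pt_eqD)

lemma finite_progs:
  assumes "finite X" "r \<ge> 2"
  shows "finite (progs r X)"
proof -
  obtain i j where ij: "i < r" "j < r" "i \<noteq> j"
    using assms(2) that[of 0 1] by auto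
  have "(\<lambda>(y, x). (pt y x (of_nat i), pt y x (of_nat j))) ` progs r X \<subseteq> X \<times> X"
    using ij by (auto simp: progs_def)
  then have "finite ((\<lambda>(y, x). (pt y x (of_nat i), pt y x (of_nat j))) ` progs r X)"
    using assms(1) finite_subset by blast
  then show ?thesis
    by (rule finite_imageD) (rule inj_on_progs[OF ij(3)])
qed

lemma poly_curve_line:
  assumes "finite J" "x \<noteq> 0"
  shows "mpoly.poly_curve J d (card J * d) r (\<lambda>k. pt y x (of_nat k))"
  unfolding mpoly.poly_curve_def
proof (intro conjI allI)
  show "inj_on (\<lambda>k. pt y x (of_nat k)) {..<r}"
    using pt_inj[OF assms(2)] by (auto simp: inj_on_def)
  fix f
  show "\<exists>P. degree P \<le> card J * d \<and> (\<forall>i<r. mev J d (pt y x (of_nat i)) f = poly P (of_nat i))"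
    using degree_line_poly[OF assms(1), of d y x f] poly_line_poly[of J d y x f]
    by (intro exI[of _ "line_poly J d y x f"]) simp
qed

definition unit_coeff :: "'b \<Rightarrow> 'b \<Rightarrow> complex" where
  "unit_coeff e e' = (if e' = e then 1 else 0)"

lemma inj_unit_coeff: "inj unit_coeff"
  by (auto simp: inj_def unit_coeff_def fun_eq_iff split: if_splits)

lemma sum_fun_apply: "(\<Sum>i\<in>A. F i) x = (\<Sum>i\<in>A. F i x)" for F :: "'a \<Rightarrow> 'b \<Rightarrow> 'c::comm_monoid_add"
  by (induction A rule: infinite_finite_induct) auto

lemma independent_unit_coeff:
  assumes "finite E"
  shows "mpoly.independent (unit_coeff ` E)"
proof -
  have "a (unit_coeff e) = 0"
    if "(\<Sum>v\<in>unit_coeff ` E. cscale (a v) v) = 0" "e \<in> E" for a e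
  proof -
    have "(\<Sum>v\<in>unit_coeff ` E. cscale (a v) v) = (\<Sum>i\<in>E. cscale (a (unit_coeff i)) (unit_coeff i))"
      using inj_unit_coeff by (subst sum.reindex) (auto intro: inj_on_subset)
    then have "(\<Sum>i\<in>E. cscale (a (unit_coeff i)) (unit_coeff i)) e = 0"
      using that by simp
    moreover have "(\<Sum>i\<in>E. cscale (a (unit_coeff i)) (unit_coeff i)) e
        = (\<Sum>i\<in>E. if i = e then a (unit_coeff i) else 0)"
      unfolding sum_fun_apply by (rule sum.cong) (auto simp: cscale_def unit_coeff_def)
    ultimately show ?thesis using assms that by simp
  qed
  then show ?thesis
    using assms by (auto simp: mpoly.dependent_finite)
qed

lemma span_unit_coeff_support:
  assumes "f \<in> mpoly.span (unit_coeff ` E)" "e \<notin> E"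
  shows "f e = 0"
proof -
  have "mpoly.span (unit_coeff ` E) \<subseteq> {f. f e = 0}"
    using assms(2)
    by (intro mpoly.span_minimal mpoly.subspaceI) (auto simp: cscale_def unit_coeff_def)
  then show ?thesis using assms(1) by blast
qed

text \<open>
  Choosing the space \<open>B\<close> of polynomials to minimise \<open>|{u \<in> X. B \<noteq> 0 at u}| / |B|\<close> makes the
  points off its zero set semistable, so few progressions can leave the zero set.
\<close>

lemma exists_vanishing_space:
  assumes J: "finite J" and X: "finite X" and r: "4 * (card J * d + 1) \<le> r"
  shows "\<exists>c. c \<noteq> 0 \<and> (\<forall>e. e \<notin> ebox J d \<longrightarrow> c e = 0) \<and>
    card (progs r X) * (d + 1) ^ card J
      \<le> card (progs r {u \<in> X. mev J d u c = 0}) * (d + 1) ^ card J + 64 * r * (card X)\<^sup>2"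
proof -
  define B0 where "B0 = unit_coeff ` ebox J d"
  define M where "M = (d + 1) ^ card J"
  define N where "N = card X"
  let ?span = "mpoly.span" and ?ind = "mpoly.independent"
  have B0: "finite B0" "?ind B0" "card B0 = M" "B0 \<noteq> {}"
  proof -
    show "finite B0" unfolding B0_def using finite_ebox[OF J] by simp
    show "?ind B0" unfolding B0_def by (rule independent_unit_coeff[OF finite_ebox[OF J]])
    show c: "card B0 = M"
      unfolding B0_def M_def card_ebox[OF J, symmetric]
      by (rule card_image) (rule inj_on_subset[OF inj_unit_coeff], simp)
    show "B0 \<noteq> {}" using c by (auto simp: M_def)
  qed
  define good where "good B \<longleftrightarrow> B \<subseteq> ?span B0 \<and> ?ind B \<and> B \<noteq> {}" for B
  have good: "finite B" "card B \<le> M" "card B > 0" if "good B" for B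
  proof -
    have "finite B \<and> card B \<le> card B0"
      using that B0 by (intro mpoly.independent_span_bound) (auto simp: good_def)
    then show "finite B" "card B \<le> M" "card B > 0"
      using that B0 by (auto simp: good_def card_gt_0_iff)
  qed
  define S where "S B = {u \<in> X. \<exists>f\<in>B. mev J d u f \<noteq> 0}" for B
  have S_le: "card (S B) \<le> N" for B
    unfolding S_def N_def using X by (intro card_mono) auto
  define \<phi> where "\<phi> B = real (card (S B)) / real (card B)" for B
  \<comment> \<open>There are infinitely many candidates \<open>B\<close>, but the slope has bounded
    numerator and denominator, so it attains a minimum.\<close>
  have "\<phi> ` Collect good \<subseteq> (\<lambda>(a, b). real a / real b) ` ({..N} \<times> {..M})"
  proof
    fix v assume "v \<in> \<phi> ` Collect good"
    then obtain B where "good B" "v = \<phi> B" by blast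
    then show "v \<in> (\<lambda>(a, b). real a / real b) ` ({..N} \<times> {..M})"
      using S_le[of B] good(2)[of B]
      by (intro image_eqI[of _ _ "(card (S B), card B)"]) (auto simp: \<phi>_def)
  qed
  then have fin: "finite (\<phi> ` Collect good)"
    by (rule finite_subset) (intro finite_imageI finite_cartesian_product finite_atMost)
  have good_B0: "good B0" using B0 mpoly.span_superset by (auto simp: good_def)
  then have ne: "\<phi> ` Collect good \<noteq> {}" by blast
  obtain B where B: "good B" "\<And>B'. good B' \<Longrightarrow> \<phi> B \<le> \<phi> B'"
    using Min_in[OF fin ne] Min_le[OF fin] by (metis imageE imageI mem_Collect_eq)
  define X0 where "X0 = X - S B"
  define C where "C = progs r X - progs r X0"
  have r2: "r \<ge> 2" using r by simp
  have finP: "finite (progs r X)" by (rule finite_progs[OF X r2])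
  have span_B: "?span B \<subseteq> ?span B0"
    using B(1) by (intro mpoly.span_minimal) (auto simp: good_def)
  have count: "card C * card B \<le> 64 * r * (card (S B))\<^sup>2"
    unfolding S_def
  proof (rule mpoly.curve_count[where J = J and d = d and p = "\<lambda>(y, x) k. pt y x (of_nat k)" and l = "card J * d"])
    show "finite X" by (rule X)
    show "finite B" by (rule good(1)[OF B(1)])
    show "?ind B" "B \<noteq> {}" using B(1) by (auto simp: good_def)
    show "card {u \<in> X. \<exists>f\<in>B. mev J d u f \<noteq> 0} * card B'
        \<le> card B * card {u \<in> X. \<exists>f\<in>B'. mev J d u f \<noteq> 0}"
      if "B' \<subseteq> ?span B" "?ind B'" "B' \<noteq> {}" for B'
    proof -
      have g: "good B'" using that span_B by (auto simp: good_def)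
      \<comment> \<open>Cross-multiplied, minimality of the slope is the semistability that
        \<open>curve_count\<close> requires.\<close>
      have "\<phi> B \<le> \<phi> B'" by (rule B(2)[OF g])
      then have "real (card (S B)) * real (card B') \<le> real (card B) * real (card (S B'))"
        using good(3)[OF g] good(3)[OF B(1)] by (simp add: \<phi>_def field_simps)
      then have "card (S B) * card B' \<le> card B * card (S B')"
        unfolding of_nat_mult[symmetric] of_nat_le_iff .
      then show ?thesis by (simp only: S_def)
    qed
    show "finite C" using finP by (simp add: C_def)
    show "mpoly.poly_curve J d (card J * d) r (case c of (y, x) \<Rightarrow> \<lambda>k. pt y x (of_nat k))"
      if "c \<in> C" for c
      using that by (auto simp: C_def progs_def intro: poly_curve_line[OF J])
    show "(case c of (y, x) \<Rightarrow> \<lambda>k. pt y x (of_nat k)) i \<in> X" if "c \<in> C" "i < r" for c i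
      using that by (auto simp: C_def progs_def)
    show "\<exists>i<r. (case c of (y, x) \<Rightarrow> \<lambda>k. pt y x (of_nat k)) i \<in> {u \<in> X. \<exists>f\<in>B. mev J d u f \<noteq> 0}"
      if "c \<in> C" for c
      using that by (auto simp: C_def progs_def X0_def S_def)
    show "inj_on (\<lambda>c. ((case c of (y, x) \<Rightarrow> \<lambda>k. pt y x (of_nat k)) i,
        (case c of (y, x) \<Rightarrow> \<lambda>k. pt y x (of_nat k)) j)) C" if "i \<noteq> j" for i j
      using inj_on_progs[OF that, of C] by (simp add: case_prod_unfold)
    show "4 * (card J * d + 1) \<le> r" by (rule r)
  qed
  \<comment> \<open>One factor \<open>card (S B)\<close> is bounded by \<open>N\<close>; the
    quotient of the other by \<open>card B\<close> is the slope, at most that of the full monomial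
    space.\<close>
  have "card C * M \<le> 64 * r * N\<^sup>2"
  proof -
    let ?n = "real (card (S B))" and ?s = "real (card B)"
    have s: "?s > 0" using good(3)[OF B(1)] by simp
    have M0: "real M > 0" by (simp add: M_def)
    have "real (card C * card B) \<le> real (64 * r * (card (S B))\<^sup>2)"
      using count by (simp only: of_nat_le_iff)
    then have "real (card C) \<le> 64 * real r * ?n * \<phi> B"
      using s by (simp add: \<phi>_def field_simps power2_eq_square)
    also have "\<dots> \<le> 64 * real r * real N * (real N / real M)"
    proof (intro mult_mono mult_left_mono)
      have "\<phi> B \<le> \<phi> B0" by (rule B(2)[OF good_B0])
      also have "\<dots> \<le> real N / real M"
        unfolding \<phi>_def B0(3) using S_le[of B0] by (intro divide_right_mono) auto
      finally show "\<phi> B \<le> real N / real M" .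
    qed (use S_le[of B] in \<open>auto simp: \<phi>_def\<close>)
    finally have "real (card C) * real M \<le> 64 * real r * (real N)\<^sup>2"
      using M0 by (simp add: field_simps power2_eq_square)
    then have "real (card C * M) \<le> real (64 * r * N\<^sup>2)" by simp
    then show ?thesis by (simp only: of_nat_le_iff)
  qed
  moreover have "card (progs r X) = card C + card (progs r X0)"
  proof -
    have sub: "progs r X0 \<subseteq> progs r X" by (rule progs_mono) (auto simp: X0_def)
    then have "card C = card (progs r X) - card (progs r X0)"
      unfolding C_def using finP by (intro card_Diff_subset) (auto intro: finite_subset)
    then show ?thesis using card_mono[OF finP sub] by simp
  qed
  ultimately have total: "card (progs r X) * M \<le> card (progs r X0) * M + 64 * r * N\<^sup>2"
    by (simp add: algebra_simps)
  obtain c where c: "c \<in> B" using B(1) by (auto simp: good_def)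
  have X0_sub: "X0 \<subseteq> {u \<in> X. mev J d u c = 0}" using c by (auto simp: X0_def S_def)
  have "card (progs r X0) \<le> card (progs r {u \<in> X. mev J d u c = 0})"
    using X by (intro card_mono finite_progs progs_mono X0_sub r2) auto
  then have "card (progs r X0) * M \<le> card (progs r {u \<in> X. mev J d u c = 0}) * M" by simp
  then have fin: "card (progs r X) * M
      \<le> card (progs r {u \<in> X. mev J d u c = 0}) * M + 64 * r * N\<^sup>2"
    using total by linarith
  show ?thesis
  proof (intro exI[of _ c] conjI allI impI)
    show "c \<noteq> 0" using c B(1) mpoly.dependent_zero by (auto simp: good_def)
    show "c e = 0" if "e \<notin> ebox J d" for e
      using c B(1) that by (intro span_unit_coeff_support[of c "ebox J d"]) (auto simp: good_def B0_def)
    show "card (progs r X) * (d + 1) ^ card J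
      \<le> card (progs r {u \<in> X. mev J d u c = 0}) * (d + 1) ^ card J + 64 * r * (card X)\<^sup>2"
      using fin by (simp only: M_def N_def)
  qed
qed

section \<open>Tangent hyperplanes with many points\<close>

text \<open>The restriction to the line has \<open>r\<close> zeros and degree below
  \<open>r\<close>, so it vanishes along with its derivative at \<open>u\<close>. The line is
  re-based at \<open>u\<close>, which turns index \<open>k\<close> into parameter
  \<open>k - k0\<close>.\<close>

lemma line_in_tangent:
  assumes J: "finite J" and r: "card J * d < r"
    and van: "\<And>z. z \<in> X \<Longrightarrow> mev J d z c = 0"
    and p: "(y, x) \<in> progs r X" and k0: "k0 < r" "pt y x (of_nat k0) = u" and k: "k < r"
  shows "(\<Sum>j\<in>J. mgrad J d u c j * pt y x (of_nat k) j) = (\<Sum>j\<in>J. mgrad J d u c j * u j)"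
proof -
  let ?P = "line_poly J d u x c"
  have pt_u: "pt u x (s - of_nat k0) = pt y x s" for s
    unfolding k0(2)[symmetric] by (simp add: pt_def algebra_simps)
  have "?P = 0"
  proof (rule ccontr)
    assume "?P \<noteq> 0"
    have "(\<lambda>k. of_nat k - of_nat k0) ` {..<r} \<subseteq> {z. poly ?P z = 0}"
      using p van by (auto simp: poly_line_poly pt_u progs_def)
    then have "card ((\<lambda>k. of_nat k - of_nat k0 :: complex) ` {..<r}) \<le> card {z. poly ?P z = 0}"
      using poly_roots_finite[OF \<open>?P \<noteq> 0\<close>] by (intro card_mono) auto
    also have "\<dots> \<le> degree ?P" using \<open>?P \<noteq> 0\<close> by (rule card_poly_roots_bound)
    also have "\<dots> \<le> card J * d" by (rule degree_line_poly[OF J])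
    finally show False using r by (simp add: card_image inj_on_def)
  qed
  then have "(\<Sum>j\<in>J. mgrad J d u c j * x j) = 0"
    using pderiv_line_poly[of J d u x c] by simp
  moreover have "pt y x (of_nat k) j = u j + (of_nat k - of_nat k0) * x j" for j
    using fun_cong[OF pt_u[of "of_nat k"], of j] by (simp add: pt_def)
  ultimately show ?thesis
    by (simp add: distrib_left sum.distrib mult.left_commute flip: sum_distrib_left)
qed

text \<open>A progression through \<open>u\<close> is determined by the position of \<open>u\<close>
  in it and by one further point.\<close>

lemma progs_through_point_le:
  assumes T: "finite T" "\<And>y x. (y, x) \<in> T \<Longrightarrow> \<exists>k<r. pt y x (of_nat k) = u"
    and H: "finite H" "\<And>y x k. (y, x) \<in> T \<Longrightarrow> k < r \<Longrightarrow> pt y x (of_nat k) \<in> H"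
    and r: "r \<ge> 2"
  shows "card T \<le> r * card H"
proof -
  define \<kappa> where "\<kappa> p = (SOME k. k < r \<and> pt (fst p) (snd p) (of_nat k) = u)" for p
  \<comment> \<open>A position different from \<open>k\<close>, and below \<open>r\<close> because
    \<open>r\<close> is at least 2.\<close>
  define \<kappa>' where "\<kappa>' k = (if k = 0 then 1 else 0 :: nat)" for k :: nat
  define h where "h p = (\<kappa> p, pt (fst p) (snd p) (of_nat (\<kappa>' (\<kappa> p))))" for p
  have \<kappa>: "\<kappa> p < r" "pt (fst p) (snd p) (of_nat (\<kappa> p)) = u" if "p \<in> T" for p
  proof -
    have "\<exists>k<r. pt (fst p) (snd p) (of_nat k) = u" using T(2)[of "fst p" "snd p"] that by simp
    then have "\<kappa> p < r \<and> pt (fst p) (snd p) (of_nat (\<kappa> p)) = u"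
      unfolding \<kappa>_def by (rule someI_ex)
    then show "\<kappa> p < r" "pt (fst p) (snd p) (of_nat (\<kappa> p)) = u" by auto
  qed
  have "inj_on h T"
  proof (rule inj_onI)
    fix p q assume pq: "p \<in> T" "q \<in> T" "h p = h q"
    then have eq: "\<kappa> p = \<kappa> q" by (simp add: h_def)
    have "pt (fst p) (snd p) (of_nat (\<kappa>' (\<kappa> q))) = pt (fst q) (snd q) (of_nat (\<kappa>' (\<kappa> q)))"
      using pq(3) eq by (simp add: h_def)
    moreover have "pt (fst p) (snd p) (of_nat (\<kappa> q)) = pt (fst q) (snd q) (of_nat (\<kappa> q))"
      using \<kappa>(2)[OF pq(1)] \<kappa>(2)[OF pq(2)] eq by simp
    moreover have "of_nat (\<kappa>' (\<kappa> q)) \<noteq> (of_nat (\<kappa> q) :: complex)"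
      by (simp add: \<kappa>'_def)
    ultimately have "fst p = fst q \<and> snd p = snd q" by (rule pt_eqD)
    then show "p = q" by (simp add: prod_eq_iff)
  qed
  moreover have "h ` T \<subseteq> {..<r} \<times> H"
  proof (rule image_subsetI)
    fix p assume p: "p \<in> T"
    have "\<kappa>' (\<kappa> p) < r" using r by (simp add: \<kappa>'_def)
    then have "pt (fst p) (snd p) (of_nat (\<kappa>' (\<kappa> p))) \<in> H"
      using H(2)[of "fst p" "snd p"] p by simp
    then show "h p \<in> {..<r} \<times> H" using \<kappa>(1)[OF p] by (simp add: h_def)
  qed
  ultimately have "card T \<le> card ({..<r} \<times> H)"
    using H(1) by (intro card_inj_on_le[of h]) auto
  then show ?thesis by (simp add: card_cartesian_product)
qed

text \<open>The point with nonzero gradient cannot be prescribed, so every candidate must be rich.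
  This is achieved by maximising the number of progressions minus \<mu> times the number of points
  over subsets of the zero set: in a maximiser, each point lies on at least \<mu>
  progressions.\<close>

lemma rich_hyperplane:
  fixes X :: "('i \<Rightarrow> complex) set"
  assumes J: "finite J" and X: "finite X" and r: "4 * (card J * d + 1) \<le> r"
    and big: "128 * r * (card X)\<^sup>2 < card (progs r X) * (d + 1) ^ card J"
  shows "\<exists>a b. (\<exists>j\<in>J. a j \<noteq> 0) \<and>
    real (card (progs r X)) / (4 * real (card X) * real r) \<le> card {z \<in> X. (\<Sum>j\<in>J. a j * z j) = b}"
proof -
  obtain c where c: "c \<noteq> 0" "\<And>e. e \<notin> ebox J d \<Longrightarrow> c e = 0"
    and le: "card (progs r X) * (d + 1) ^ card J
      \<le> card (progs r {u \<in> X. mev J d u c = 0}) * (d + 1) ^ card J + 64 * r * (card X)\<^sup>2"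
    using exists_vanishing_space[OF J X r] by blast
  define X0 where "X0 = {u \<in> X. mev J d u c = 0}"
  define m where "m = real (card (progs r X))"
  define m0 where "m0 = real (card (progs r X0))"
  define N where "N = real (card X)"
  \<comment> \<open>The total penalty is at most \<open>m / 4\<close>, while the zero set retains
    more than \<open>m / 2\<close> progressions; so the maximum is positive and the maximiser
    nonempty.\<close>
  define \<mu> where "\<mu> = m / (4 * N)"
  have r2: "r \<ge> 2" and rd: "card J * d < r" using r by simp_all
  have X0: "X0 \<subseteq> X" "finite X0" using X by (auto simp: X0_def)
  \<comment> \<open>The constant 128 is twice the 64 of the count: fewer than half of the
    progressions leave the zero set.\<close>
  have "card (progs r X) * (d + 1) ^ card J < (2 * card (progs r X0)) * (d + 1) ^ card J"
    using le big unfolding X0_def by linarith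
  then have "card (progs r X) < 2 * card (progs r X0)" by (simp only: mult_less_cancel2)
  then have m0: "m < 2 * m0" by (simp add: m_def m0_def)
  define g where "g Y = real (card (progs r Y)) - \<mu> * real (card Y)" for Y :: "('i \<Rightarrow> complex) set"
  have finP: "finite (g ` Pow X0)" using X0 by simp
  have "Max (g ` Pow X0) \<in> g ` Pow X0" using finP by (intro Max_in) auto
  then obtain X1 where X1: "X1 \<subseteq> X0" "g X1 = Max (g ` Pow X0)" by auto
  have g_max: "g Y \<le> g X1" if "Y \<subseteq> X0" for Y
    unfolding X1(2) using finP that by (intro Max_ge) auto
  have X1': "finite X1" "X1 \<subseteq> X" using X1 X0 finite_subset by blast+
  have "\<mu> * real (card X0) \<le> m / 4"
  proof (cases "N = 0")
    case False
    then have "N > 0" by (simp add: N_def)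
    have "\<mu> * real (card X0) \<le> \<mu> * N"
      using card_mono[OF X X0(1)] by (intro mult_left_mono) (auto simp: N_def \<mu>_def m_def)
    then show ?thesis using \<open>N > 0\<close> by (simp add: \<mu>_def)
  qed (simp add: \<mu>_def m_def)
  then have "g X0 > 0" using m0 by (simp add: g_def m0_def m_def)
  then have g1: "g X1 > 0" using g_max[of X0] by simp
  have "progs r ({} :: ('i \<Rightarrow> complex) set) = {}" using r2 by (auto simp: progs_def intro!: exI[of _ 0])
  then have "X1 \<noteq> {}" using g1 by (auto simp: g_def)
  have "\<exists>c'. \<exists>u\<in>X1. \<exists>j\<in>J. (\<forall>z\<in>X1. mev J d z c' = 0) \<and> mgrad J d u c' j \<noteq> 0"
  proof (rule exists_nonzero_gradient[OF J \<open>X1 \<noteq> {}\<close> c])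
    show "mev J d u c = 0" if "u \<in> X1" for u using that X1(1) by (auto simp: X0_def)
  qed
  then obtain c' u j where c': "\<forall>z\<in>X1. mev J d z c' = 0" and u: "u \<in> X1"
    and j: "j \<in> J" "mgrad J d u c' j \<noteq> 0"
    by blast
  define T where "T = {(y, x) \<in> progs r X1. \<exists>k<r. pt y x (of_nat k) = u}"
  have finX1: "finite (progs r X1)" by (rule finite_progs[OF X1'(1) r2])
  have T: "T \<subseteq> progs r X1" "finite T"
    using finite_subset[OF _ finX1, of T] by (auto simp: T_def)
  \<comment> \<open>Deleting \<open>u\<close> costs exactly the progressions in \<open>T\<close> and
    saves the penalty \<mu>.\<close>
  have "progs r (X1 - {u}) = progs r X1 - T"
    by (auto simp: progs_def T_def)
  then have "card (progs r (X1 - {u})) = card (progs r X1) - card T"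
    using T by (simp add: card_Diff_subset)
  moreover have "card T \<le> card (progs r X1)" using finX1 T by (intro card_mono)
  moreover have "card X1 = Suc (card (X1 - {u}))"
    using u X1'(1) by (rule card.remove[rotated])
  moreover have "g (X1 - {u}) \<le> g X1" using X1 by (intro g_max) auto
  ultimately have lam: "\<mu> \<le> card T" by (simp add: g_def algebra_simps)
  define a where "a = mgrad J d u c'"
  define b where "b = (\<Sum>j\<in>J. a j * u j)"
  define H where "H = {z \<in> X. (\<Sum>j\<in>J. a j * z j) = b}"
  have "card T \<le> r * card H"
  proof (rule progs_through_point_le[OF T(2) _ _ _ r2])
    show "finite H" using X by (simp add: H_def)
    show "\<exists>k<r. pt y x (of_nat k) = u" if "(y, x) \<in> T" for y x
      using that by (auto simp: T_def)
    show "pt y x (of_nat k) \<in> H" if yx: "(y, x) \<in> T" and k: "k < r" for y x k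
    proof -
      obtain k0 where k0: "k0 < r" "pt y x (of_nat k0) = u" using yx by (auto simp: T_def)
      have p: "(y, x) \<in> progs r X1" using yx T by blast
      then have "pt y x (of_nat k) \<in> X" using k X1' by (auto simp: progs_def)
      moreover have "(\<Sum>j\<in>J. a j * pt y x (of_nat k) j) = b"
        unfolding a_def b_def using c' by (intro line_in_tangent[OF J rd _ p k0 k]) auto
      ultimately show ?thesis by (simp add: H_def)
    qed
  qed
  then have "real (card T) \<le> real (r * card H)" by (simp only: of_nat_le_iff)
  then have "\<mu> \<le> real r * real (card H)" using lam by simp
  then have "\<mu> / real r \<le> card H" using r2 by (simp add: pos_divide_le_eq mult.commute)
  moreover have "\<mu> / real r = m / (4 * N * real r)" by (simp add: \<mu>_def)
  ultimately have "m / (4 * N * real r) \<le> card H" by simp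
  then show ?thesis
    using j unfolding m_def N_def H_def a_def by blast
qed

section \<open>Powers of the point set\<close>

text \<open>Coordinates of a point of the \<open>k\<close>-th power. The index type cannot depend on
  \<open>k\<close>, so it is infinite, and padding by zero makes the result depend on the first
  \<open>k\<close> components only.\<close>

definition flat :: "nat \<Rightarrow> (nat \<Rightarrow> complex ^ 'd) \<Rightarrow> nat \<times> 'd \<Rightarrow> complex" where
  "flat k F = (\<lambda>(l, i). if l < k then F l $ i else 0)"

definition tuples :: "nat \<Rightarrow> 'a set \<Rightarrow> (nat \<Rightarrow> 'a) set" where
  "tuples k V = {..<k} \<rightarrow>\<^sub>E V"

lemma flat_eqD: "flat k F = flat k G \<Longrightarrow> l < k \<Longrightarrow> F l = G l"
  by (auto simp: flat_def fun_eq_iff vec_eq_iff split: if_splits)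

lemma flat_cong: "(\<And>l. l < k \<Longrightarrow> F l = G l) \<Longrightarrow> flat k F = flat k G"
  by (auto simp: flat_def fun_eq_iff)

lemma inj_on_flat: "inj_on (flat k) (tuples k V)"
proof (rule inj_onI)
  fix F G assume "F \<in> tuples k V" "G \<in> tuples k V" "flat k F = flat k G"
  then show "F = G"
    unfolding tuples_def by (intro PiE_ext[of F _ _ G]) (auto dest: flat_eqD)
qed

lemma card_flat_tuples: "finite V \<Longrightarrow> card (flat k ` tuples k V) = card V ^ k"
  by (simp add: card_image[OF inj_on_flat]) (simp add: tuples_def card_PiE)

lemma pt_flat: "pt (flat k Y) (flat k Z) s = flat k (\<lambda>l. Y l + s *s Z l)"
  by (auto simp: pt_def flat_def fun_eq_iff)

text \<open>Progressions of equal length run in parallel: \<open>k\<close> of them, read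
  componentwise, form one progression in the power, and they can be recovered from it.\<close>

lemma card_progs_flat:
  fixes V :: "(complex ^ 'd) set"
  assumes V: "finite V" and r: "r \<ge> 2" and k: "k > 0"
  shows "num_arith_progs r V ^ k \<le> card (progs r (flat k ` tuples k V))"
proof -
  define P where "P = {(y, x). x \<noteq> 0 \<and> (\<forall>j<r. y + of_nat j *s x \<in> V)}"
  have "inj_on (\<lambda>p. (fst p, fst p + snd p)) P"
    by (rule inj_onI) (metis Pair_inject add_left_cancel prod_eqI)
  moreover have "(\<lambda>p. (fst p, fst p + snd p)) ` P \<subseteq> V \<times> V"
  proof (rule image_subsetI)
    fix p assume "p \<in> P"
    then have *: "fst p + of_nat j *s snd p \<in> V" if "j < r" for j
      using that by (simp add: P_def case_prod_unfold)
    show "(fst p, fst p + snd p) \<in> V \<times> V" using *[of 0] *[of 1] r by simp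
  qed
  then have "finite ((\<lambda>p. (fst p, fst p + snd p)) ` P)"
    using finite_cartesian_product[OF V V] by (rule finite_subset)
  ultimately have finP: "finite P" by (rule finite_imageD[rotated])
  have "{A. A \<subseteq> V \<and> arith_prog r A} \<subseteq> (\<lambda>(y, x). (\<lambda>j. y + of_nat j *s x) ` {..<r}) ` P"
  proof clarify
    fix A assume A: "A \<subseteq> V" "arith_prog r A"
    then obtain y x where yx: "A = (\<lambda>j. y + of_nat j *s x) ` {..<r}" "card A = r"
      by (auto simp: arith_prog_def)
    have "x \<noteq> 0"
    proof
      assume "x = 0"
      then have "A \<subseteq> {y}" using yx by auto
      then have "card A \<le> 1" using card_mono[of "{y}" A] by simp
      then show False using yx r by simp
    qed
    then have "(y, x) \<in> P" using A yx by (auto simp: P_def)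
    then show "A \<in> (\<lambda>(y, x). (\<lambda>j. y + of_nat j *s x) ` {..<r}) ` P"
      using yx by force
  qed
  then have "num_arith_progs r V \<le> card P"
    unfolding num_arith_progs_def using finP by (rule surj_card_le[rotated])
  then have "num_arith_progs r V ^ k \<le> card P ^ k" by (rule power_mono) simp
  also have "\<dots> = card (tuples k P)" by (simp add: tuples_def card_PiE)
  also have "\<dots> \<le> card (progs r (flat k ` tuples k V))"
  proof (rule card_inj_on_le[where f = "\<lambda>q. (flat k (\<lambda>l. fst (q l)), flat k (\<lambda>l. snd (q l)))"])
    show "inj_on (\<lambda>q. (flat k (\<lambda>l. fst (q l)), flat k (\<lambda>l. snd (q l)))) (tuples k P)"
    proof (rule inj_onI)
      fix p q assume pq: "p \<in> tuples k P" "q \<in> tuples k P"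
        "(flat k (\<lambda>l. fst (p l)), flat k (\<lambda>l. snd (p l)))
          = (flat k (\<lambda>l. fst (q l)), flat k (\<lambda>l. snd (q l)))"
      have "p l = q l" if "l < k" for l
        using pq(3) flat_eqD[of k "\<lambda>l. fst (p l)" "\<lambda>l. fst (q l)" l]
          flat_eqD[of k "\<lambda>l. snd (p l)" "\<lambda>l. snd (q l)" l] that by (simp add: prod_eq_iff)
      then show "p = q" using pq(1,2) unfolding tuples_def by (intro PiE_ext) auto
    qed
    show "(\<lambda>q. (flat k (\<lambda>l. fst (q l)), flat k (\<lambda>l. snd (q l)))) ` tuples k P
        \<subseteq> progs r (flat k ` tuples k V)"
    proof (rule image_subsetI)
      fix q assume "q \<in> tuples k P"
      then have q: "q l \<in> P" if "l < k" for l using that by (auto simp: tuples_def)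
      have "flat k (\<lambda>l. snd (q l)) \<noteq> 0"
      proof
        assume "flat k (\<lambda>l. snd (q l)) = 0"
        then have "flat k (\<lambda>l. snd (q l)) = flat k (\<lambda>_. 0)" by (auto simp: flat_def fun_eq_iff)
        then have "snd (q 0) = 0" using flat_eqD[OF _ k] by blast
        then show False using q[OF k] by (auto simp: P_def)
      qed
      moreover have "pt (flat k (\<lambda>l. fst (q l))) (flat k (\<lambda>l. snd (q l))) (of_nat j)
          \<in> flat k ` tuples k V" if j: "j < r" for j
      proof
        let ?F = "\<lambda>l. fst (q l) + of_nat j *s snd (q l)"
        show "pt (flat k (\<lambda>l. fst (q l))) (flat k (\<lambda>l. snd (q l))) (of_nat j)
            = flat k (restrict ?F {..<k})"
          unfolding pt_flat by (rule flat_cong) simp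
        have "?F l \<in> V" if "l < k" for l
          using q[OF that] j by (auto simp: P_def split: prod.splits)
        then show "restrict ?F {..<k} \<in> tuples k V" by (auto simp: tuples_def)
      qed
      ultimately show "(flat k (\<lambda>l. fst (q l)), flat k (\<lambda>l. snd (q l))) \<in> progs r (flat k ` tuples k V)"
        by (auto simp: progs_def)
    qed
    show "finite (progs r (flat k ` tuples k V))"
      using V by (intro finite_progs[OF _ r] finite_imageI) (simp add: tuples_def finite_PiE)
  qed
  finally show ?thesis .
qed

text \<open>Fixing all components but one turns a hyperplane of the power into one of the factor.\<close>

lemma hyperplane_slice:
  fixes V :: "(complex ^ 'd) set" and a :: "nat \<times> 'd \<Rightarrow> complex"
  assumes V: "finite V" "V \<noteq> {}" and a: "l < k" "a (l, i) \<noteq> 0"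
    and Z: "Z = {z \<in> flat k ` tuples k V. (\<Sum>j\<in>{..<k} \<times> UNIV. a j * z j) = b}"
  shows "\<exists>W\<subseteq>V. card Z \<le> card V ^ (k - 1) * card W \<and> (\<exists>H. affine_hyperplane H \<and> W \<subseteq> H)"
proof -
  define K where "K = {..<k} - {l}"
  define Q where "Q = K \<rightarrow>\<^sub>E V"
  have K: "finite K" "card K = k - 1" using a by (auto simp: K_def)
  have Q: "finite Q" "card Q = card V ^ (k - 1)" "Q \<noteq> {}"
    using V K by (auto simp: Q_def card_PiE finite_PiE PiE_eq_empty_iff)
  define Y where "Y = {F \<in> tuples k V. (\<Sum>m<k. \<Sum>i\<in>UNIV. a (m, i) * F m $ i) = b}"
  define W where "W G = {F l |F. F \<in> Y \<and> restrict F K = G}" for G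
  have WV: "W G \<subseteq> V" for G using a by (auto simp: W_def Y_def tuples_def)
  then have finW: "finite (W G)" for G using V(1) finite_subset by blast
  have "(\<Sum>j\<in>{..<k} \<times> UNIV. a j * flat k F j) = (\<Sum>m<k. \<Sum>i\<in>UNIV. a (m, i) * F m $ i)"
    for F :: "nat \<Rightarrow> complex ^ 'd"
  proof -
    have "(\<Sum>j\<in>{..<k} \<times> UNIV. a j * flat k F j)
        = (\<Sum>(m, i)\<in>{..<k} \<times> UNIV. a (m, i) * F m $ i)"
      by (rule sum.cong) (auto simp: flat_def)
    then show ?thesis by (simp add: sum.cartesian_product)
  qed
  then have "Z = flat k ` Y" by (auto simp: Z Y_def)
  then have "card Z = card Y"
    using inj_on_subset[OF inj_on_flat, of Y k V] by (auto simp: Y_def intro!: card_image)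
  also have "card Y \<le> card (SIGMA G:Q. W G)"
  proof (rule card_inj_on_le[where f = "\<lambda>F. (restrict F K, F l)"])
    show "inj_on (\<lambda>F. (restrict F K, F l)) Y"
    proof (rule inj_onI)
      fix F G assume FG: "F \<in> Y" "G \<in> Y" "(restrict F K, F l) = (restrict G K, G l)"
      have "F m = G m" if "m < k" for m
      proof (cases "m = l")
        case False
        then have "m \<in> K" using that by (simp add: K_def)
        moreover have "restrict F K = restrict G K" using FG(3) by blast
        then have "restrict F K m = restrict G K m" by (rule fun_cong)
        ultimately show ?thesis by simp
      qed (use FG(3) in simp)
      then show "F = G"
        using FG(1,2) unfolding Y_def tuples_def
        by (intro PiE_ext[of F "{..<k}" "\<lambda>_. V" G]) auto
    qed
    show "(\<lambda>F. (restrict F K, F l)) ` Y \<subseteq> (SIGMA G:Q. W G)"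
    proof (rule image_subsetI)
      fix F assume F: "F \<in> Y"
      then have "restrict F K \<in> Q"
        by (auto simp: Y_def tuples_def Q_def K_def)
      moreover have "F l \<in> W (restrict F K)" using F by (auto simp: W_def)
      ultimately show "(restrict F K, F l) \<in> (SIGMA G:Q. W G)" by simp
    qed
    show "finite (SIGMA G:Q. W G)" using Q finW by (intro finite_SigmaI) auto
  qed
  also have "\<dots> = (\<Sum>G\<in>Q. card (W G))" using Q finW by simp
  finally have cZ: "card Z \<le> (\<Sum>G\<in>Q. card (W G))" .
  \<comment> \<open>Averaging over the \<open>card V ^ (k - 1)\<close> choices of the other
    components: the largest slice is at least the mean.\<close>
  have "Max ((\<lambda>G. card (W G)) ` Q) \<in> (\<lambda>G. card (W G)) ` Q"
    using Q by (intro Max_in) auto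
  then obtain G where G: "G \<in> Q" "card (W G) = Max ((\<lambda>G. card (W G)) ` Q)" by auto
  have G_max: "card (W G') \<le> card (W G)" if "G' \<in> Q" for G'
    unfolding G(2) using Q(1) that by (intro Max_ge) auto
  have "card Z \<le> card V ^ (k - 1) * card (W G)"
    using cZ sum_bounded_above[of Q "\<lambda>G. card (W G)" "card (W G)"] G_max Q(2) by simp
  moreover have "\<exists>H. affine_hyperplane H \<and> W G \<subseteq> H"
  proof -
    define v where "v = (\<chi> i. a (l, i))"
    \<comment> \<open>The fixed components contribute a constant, which is moved to the right-hand
      side.\<close>
    define b' where "b' = b - (\<Sum>m\<in>K. \<Sum>i\<in>UNIV. a (m, i) * G m $ i)"
    have "v \<noteq> 0" using a(2) by (auto simp: v_def vec_eq_iff)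
    then have "affine_hyperplane {x. (\<Sum>i\<in>UNIV. v $ i * x $ i) = b'}"
      by (auto simp: affine_hyperplane_def)
    moreover have "W G \<subseteq> {x. (\<Sum>i\<in>UNIV. v $ i * x $ i) = b'}"
    proof
      fix x assume "x \<in> W G"
      then obtain F where F: "x = F l" "F \<in> Y" "restrict F K = G" by (auto simp: W_def)
      have "(\<Sum>m<k. \<Sum>i\<in>UNIV. a (m, i) * F m $ i)
          = (\<Sum>i\<in>UNIV. a (l, i) * F l $ i) + (\<Sum>m\<in>K. \<Sum>i\<in>UNIV. a (m, i) * F m $ i)"
        unfolding K_def using a(1) by (intro sum.remove) auto
      also have "(\<Sum>m\<in>K. \<Sum>i\<in>UNIV. a (m, i) * F m $ i)
          = (\<Sum>m\<in>K. \<Sum>i\<in>UNIV. a (m, i) * G m $ i)"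
        using F(3) by (intro sum.cong refl) auto
      finally have "(\<Sum>i\<in>UNIV. a (l, i) * F l $ i) = b'"
        using F(2) by (simp add: Y_def b'_def eq_diff_eq)
      then show "x \<in> {x. (\<Sum>i\<in>UNIV. v $ i * x $ i) = b'}" by (simp add: F(1) v_def)
    qed
    ultimately show ?thesis by blast
  qed
  ultimately show ?thesis using WV by blast
qed

section \<open>Choice of parameters and the final estimate\<close>

text \<open>\<open>(r - 4) div (4 * D)\<close> is the largest exponent bound that
  \<open>rich_hyperplane\<close> admits in \<open>D\<close> variables. For \<open>r < 8\<close> the
  summand 1 suffices; otherwise \<open>r - 4\<close> is at least \<open>r / 2\<close>.\<close>

lemma box_size_lower_bound:
  fixes r D :: nat
  assumes "D \<ge> 1" "r \<ge> 4"
  shows "(real r / (8 * real D)) ^ D \<le> real (((r - 4) div (4 * D) + 1) ^ D)"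
proof -
  have "real r / (8 * real D) \<le> real ((r - 4) div (4 * D) + 1)"
  proof (cases "r < 8")
    case True
    have "real r \<le> 8 * real D" using True assms by simp
    then have "real r / (8 * real D) \<le> 1" using assms by simp
    then show ?thesis by simp
  next
    case False
    define q where "q = (r - 4) div (4 * D)"
    have "r - 4 < (q + 1) * (4 * D)"
      unfolding q_def using assms by (simp add: dividend_less_div_times)
    then have "real (r - 4) < real ((q + 1) * (4 * D))" by (simp only: of_nat_less_iff)
    define t where "t = (real q + 1) * real D"
    have "real r - 4 < 4 * t"
      using \<open>real (r - 4) < _\<close> assms by (simp add: t_def of_nat_diff algebra_simps)
    then have "2 * (real r - 4) < 8 * t" by simp
    moreover have "real r \<le> 2 * (real r - 4)" using False by simp
    ultimately have "real r \<le> 8 * t" by (rule order_trans[OF _ less_imp_le, rotated])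
    then have "real r \<le> (real q + 1) * (8 * real D)" by (simp add: t_def mult.left_commute)
    then show ?thesis using assms by (simp add: q_def[symmetric] pos_divide_le_eq add.commute)
  qed
  then show ?thesis
    unfolding of_nat_power by (intro power_mono) auto
qed

text \<open>
  The counting bound loses a factor \<open>r\<close>. Applied to \<open>V\<^sup>k\<close> with \<open>k = \<lceil>1/\<epsilon>\<rceil>\<close>, this loss is
  covered by the \<open>k\<close>-fold gain \<open>r\<^bsup>\<epsilon> k\<^esup>\<close>; since \<open>\<epsilon> k < 2\<close>, the final exponent is as claimed.
\<close>

theorem theorem2:
  fixes \<epsilon> :: real
  assumes "0 < \<epsilon>" and "\<epsilon> < 1"
  shows "\<exists>C>0. \<exists>c>0. \<forall>(V :: (complex ^ 'd) set) (r :: nat).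
    finite V \<longrightarrow> r \<ge> 4 \<longrightarrow>
    real (num_arith_progs r V)
      \<ge> C * ((real (card V))\<^sup>2 / real r powr (real CARD('d) - \<epsilon>)) \<longrightarrow>
    (\<exists>W \<subseteq> V. real (card W)
        \<ge> c * (real (card V) / real r powr (2 * real CARD('d) / \<epsilon> - 1)) \<and>
      (\<exists>H. affine_hyperplane H \<and> W \<subseteq> H))"
proof -
  define d where "d = real CARD('d)"
  define k where "k = nat \<lceil>1 / \<epsilon>\<rceil>"
  define D where "D = k * CARD('d)"
  \<comment> \<open>129 beats the 128 of \<open>rich_hyperplane\<close>, and the power of
    \<open>8 * D\<close> cancels the loss in \<open>box_size_lower_bound\<close>.\<close>
  define C where "C = 129 * (8 * real D) ^ D"
  have d1: "d \<ge> 1" by (simp add: d_def Suc_leI)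
  have k_ge: "1 / \<epsilon> \<le> real k" unfolding k_def by (rule real_nat_ceiling_ge)
  then have ek1: "\<epsilon> * real k \<ge> 1" using assms by (simp add: field_simps)
  have "real k < 1 / \<epsilon> + 1"
  proof -
    have "1 / \<epsilon> > 0" using assms by simp
    then have "real k = of_int \<lceil>1 / \<epsilon>\<rceil>" unfolding k_def by simp
    then show ?thesis using ceiling_correct[of "1 / \<epsilon>"] by linarith
  qed
  then have "\<epsilon> * real k < \<epsilon> * (1 / \<epsilon> + 1)" using assms by simp
  also have "\<dots> = 1 + \<epsilon>" using assms by (simp add: algebra_simps)
  finally have ek2: "\<epsilon> * real k < 2" using assms by linarith
  have k0: "k > 0" using k_ge assms by (cases "k = 0") auto
  have D1: "D \<ge> 1" using k0 by (simp add: D_def Suc_leI)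
  have C1: "C \<ge> 1"
  proof -
    have "(8 * real D) ^ D \<ge> 1" using D1 by (intro one_le_power) simp
    then show ?thesis by (simp add: C_def)
  qed
  define s where "s = real k * (d - \<epsilon>)"
  \<comment> \<open>The difference of the two sides factors as (2 - \<epsilon> k) (d / \<epsilon> -
    1), and both factors are nonnegative.\<close>
  have exponent: "s + 1 \<le> 2 * d / \<epsilon> - 1"
  proof -
    have "0 \<le> (2 - \<epsilon> * real k) * (d / \<epsilon> - 1)"
    proof (rule mult_nonneg_nonneg)
      have "\<epsilon> \<le> d" using assms d1 by linarith
      then show "0 \<le> d / \<epsilon> - 1" using assms by simp
    qed (use ek2 in simp)
    also have "\<dots> = 2 * d / \<epsilon> - 2 - s" using assms by (simp add: s_def field_simps)
    finally show ?thesis by simp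
  qed
  have main: "\<exists>W\<subseteq>V. real (card W) \<ge> 1 / 4 * (real (card V) / real r powr (2 * d / \<epsilon> - 1)) \<and>
      (\<exists>H. affine_hyperplane H \<and> W \<subseteq> H)"
    if V: "finite V" and r: "r \<ge> 4"
      and rich: "real (num_arith_progs r V) \<ge> C * ((real (card V))\<^sup>2 / real r powr (d - \<epsilon>))"
    for V :: "(complex ^ 'd) set" and r :: nat
  proof (cases "V = {}")
    case True
    have "(1 :: complex ^ 'd) \<noteq> 0" by (simp add: vec_eq_iff)
    then have "affine_hyperplane {x :: complex ^ 'd. (\<Sum>i\<in>UNIV. 1 $ i * x $ i) = 0}"
      unfolding affine_hyperplane_def by blast
    then show ?thesis using True by auto
  next
    case False
    define n where "n = card V"
    have n0: "n > 0" using V False by (simp add: n_def card_gt_0_iff)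
    define J where "J = {..<k} \<times> (UNIV :: 'd set)"
    have J: "finite J" "card J = D" by (auto simp: J_def D_def card_cartesian_product)
    define X where "X = flat k ` tuples k V"
    have X: "finite X" "card X = n ^ k"
      using V card_flat_tuples[OF V, of k]
      by (auto simp: X_def n_def tuples_def finite_PiE intro!: finite_imageI)
    define e where "e = (r - 4) div (4 * D)"
    have re: "4 * (card J * e + 1) \<le> r"
    proof -
      have "e * (4 * D) \<le> r - 4" unfolding e_def by (rule div_times_less_eq_dividend)
      then show ?thesis using r J(2) by (simp add: algebra_simps)
    qed
    define m where "m = real (card (progs r X))"
    define N where "N = real n ^ k"
    have N0: "N > 0" using n0 by (simp add: N_def)
    have r0: "real r > 0" "real r \<ge> 1" using r by auto
    have m_ge: "C ^ k * (N\<^sup>2 / real r powr s) \<le> m"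
    proof -
      have "C ^ k * (N\<^sup>2 / real r powr s) = (C * ((real n)\<^sup>2 / real r powr (d - \<epsilon>))) ^ k"
        using r0 by (simp add: power_mult_distrib power_divide N_def s_def powr_powr powr_realpow
            mult.commute flip: power_mult powr_power)
      also have "\<dots> \<le> real (num_arith_progs r V) ^ k"
        using rich C1 by (intro power_mono) (auto simp: n_def)
      also have "\<dots> \<le> m"
        using card_progs_flat[OF V _ k0, of r] r unfolding m_def X_def
        by (simp flip: of_nat_power)
      finally show ?thesis .
    qed
    have "C ^ 1 \<le> C ^ k" using C1 k0 by (intro power_increasing) auto
    then have Ck: "C \<le> C ^ k" by simp
    have big: "128 * r * (card X)\<^sup>2 < card (progs r X) * (e + 1) ^ card J"
    proof -
      \<comment> \<open>The exponent \<open>D - s\<close> equals \<epsilon> k, which is at least 1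
        and so pays for the lost factor \<open>r\<close>.\<close>
      have "real r powr (real D) / real r powr s \<ge> real r powr 1"
      proof -
        have "real D - s \<ge> 1" using ek1 by (simp add: D_def s_def d_def algebra_simps)
        then have "real r powr 1 \<le> real r powr (real D - s)" using r0 by (intro powr_mono)
        then show ?thesis by (simp add: powr_diff)
      qed
      then have gain: "real r \<le> real r ^ D / real r powr s"
        using r0 by (simp add: powr_realpow)
      have "128 * real r * N\<^sup>2 < 129 * real r * N\<^sup>2" using r0 N0 by simp
      also have "\<dots> \<le> 129 * (real r ^ D / real r powr s) * N\<^sup>2"
        using gain by (intro mult_right_mono mult_left_mono) auto
      also have "\<dots> = C * (N\<^sup>2 / real r powr s) * (real r / (8 * real D)) ^ D"
        using D1 by (simp add: C_def power_divide)
      also have "\<dots> \<le> C ^ k * (N\<^sup>2 / real r powr s) * (real r / (8 * real D)) ^ D"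
        using Ck by (intro mult_right_mono) auto
      also have "\<dots> \<le> m * real ((e + 1) ^ D)"
        unfolding e_def using m_ge C1 box_size_lower_bound[OF D1 r]
        by (intro mult_mono) (auto simp: m_def)
      finally have "real (128 * r * (card X)\<^sup>2) < real (card (progs r X) * (e + 1) ^ card J)"
        by (simp add: m_def N_def X(2) J(2))
      then show ?thesis by (simp only: of_nat_less_iff)
    qed
    obtain a b where a: "\<exists>j\<in>J. a j \<noteq> 0"
      and ab: "real (card (progs r X)) / (4 * real (card X) * real r)
        \<le> card {z \<in> X. (\<Sum>j\<in>J. a j * z j) = b}"
      using rich_hyperplane[OF J(1) X(1) re big] by blast
    then obtain l i where li: "l < k" "a (l, i) \<noteq> 0" by (auto simp: J_def)
    define Z where "Z = {z \<in> flat k ` tuples k V. (\<Sum>j\<in>{..<k} \<times> UNIV. a j * z j) = b}"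
    obtain W where W: "W \<subseteq> V" "card Z \<le> card V ^ (k - 1) * card W"
      "\<exists>H. affine_hyperplane H \<and> W \<subseteq> H"
      using hyperplane_slice[OF V False li Z_def] by blast
    \<comment> \<open>The constant \<open>C\<close> is only needed for \<open>big\<close>; dropping
      it here leaves \<open>c = 1 / 4\<close>, from the 4 in \<open>rich_hyperplane\<close>.\<close>
    have "1 * (N\<^sup>2 / real r powr s) \<le> C ^ k * (N\<^sup>2 / real r powr s)"
      using Ck C1 by (intro mult_right_mono) auto
    then have "N\<^sup>2 / real r powr s \<le> m" using m_ge by linarith
    then have "N\<^sup>2 / real r powr s / (4 * N * real r) \<le> m / (4 * N * real r)"
      using N0 r0 by (intro divide_right_mono) auto
    also have "\<dots> \<le> card Z"
      using ab by (simp add: m_def N_def X(2) Z_def X_def[symmetric] J_def[symmetric])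
    also have "\<dots> \<le> real (n ^ (k - 1) * card W)"
      using W(2) by (simp only: of_nat_le_iff n_def)
    also have "\<dots> = real n ^ (k - 1) * real (card W)" by simp
    finally have "N\<^sup>2 / real r powr s / (4 * N * real r) \<le> real n ^ (k - 1) * real (card W)" .
    moreover have "N\<^sup>2 / real r powr s / (4 * N * real r)
        = real n ^ (k - 1) * (1 / 4 * (real n / real r powr (s + 1)))"
    proof -
      have "N = real n ^ (k - 1) * real n"
        unfolding N_def using k0 by (metis Suc_diff_1 power_Suc2)
      then show ?thesis
        using N0 r0 by (simp add: powr_add power2_eq_square field_simps)
    qed
    ultimately have "real n ^ (k - 1) * (1 / 4 * (real n / real r powr (s + 1)))
        \<le> real n ^ (k - 1) * real (card W)" by (simp only:)
    moreover have "real n ^ (k - 1) > 0" using n0 by simp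
    ultimately have "1 / 4 * (real n / real r powr (s + 1)) \<le> card W"
      by (simp only: mult_le_cancel_left_pos)
    moreover have "real n / real r powr (2 * d / \<epsilon> - 1) \<le> real n / real r powr (s + 1)"
      using r0 exponent by (intro divide_left_mono powr_mono) auto
    ultimately have "1 / 4 * (real n / real r powr (2 * d / \<epsilon> - 1)) \<le> card W" by linarith
    then show ?thesis using W unfolding n_def by blast
  qed
  have "C > 0" "(1 / 4 :: real) > 0" using C1 by simp_all
  then show ?thesis using main unfolding d_def by blast
qed

end
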